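(* Let $(Z_t)_{t\in\mathbb Z}$ be i.i.d. real random variables with $\mathbb E Z_t=0$, $\mathbb E Z_t^2=1$. Let $a_j:[0,1]\to[0,\infty)$, $j\ge0$, be functions for which there are constants $0<\rho,Q,M<\infty$, $0<\nu<1$ and a positive sequence $(\ell(j))_{j\ge0}$ with $\sum_{j\ge1}j/\ell(j)<\infty$ such that $\inf_ua_0(u)>\rho$; $\sup_ua_j(u)\le Q/\ell(j)$ and $|a_j(u)-a_j(v)|\le M|u-v|/\ell(j)$ for all $j\ge0$ and $u,v$; and $Q\sum_{j\ge1}1/\ell(j)\le1-\nu$. Assume further that the third derivatives of the $a_j$ exist and that $\sup_u|\partial^ia_j(u)/\partial u^i|\le C/\ell(j)$ for $i=1,2,3$, $j=0,1,\dots$, with a finite constant $C$ independent of $i$ and $j$. Let $\{\tilde X_t(u)\}_{t\in\mathbb Z}$ be the stationary ARCH($\infty$) process at $u$ with coefficients $a_j(u)$. Then the derivatives $$\left\{\frac{\partial\tilde X_t(u)^2}{\partial u}\right\}_t,\qquad\left\{\frac{\partial^2\tilde X_t(u)^2}{\partial u^2}\right\}_t,\qquad\left\{\frac{\partial^3\tilde X_t(u)^2}{\partial u^3}\right\}_t$$ are almost surely well-defined unique stationary stochastic processes for each $u\in(0,1)$. Furthermore, $\partial\tilde X_t(u)^2/\partial u$ is almost surely the unique solution of the stochastic differential equation $$\frac{\partial\tilde X_t(u)^2}{\partial u}=\left(a_0'(u)+\sum_{j=1}^\infty a_j'(u)\tilde X_{t-j}(u)^2+\sum_{j=1}^\infty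 a_j(u)\frac{\partial\tilde X_{t-j}(u)^2}{\partial u}\right)Z_t^2,$$ where $a_j'(u)$ denotes the derivative of $a_j(u)$ with respect to $u$.
   Context: The stationary ARCH($\infty$) process at $u$ satisfies $\tilde X_t(u)=\sigma_t(u)Z_t$, $\sigma_t(u)^2=a_0(u)+\sum_{j\ge1}a_j(u)\tilde X_{t-j}(u)^2$ for $t\in\mathbb Z$; its square is given almost surely by the Volterra series $$\tilde X_t(u)^2=a_0(u)Z_t^2+\sum_{k\ge1}\sum_{j_1,\dots,j_k\ge1}a_0(u)\prod_{r=1}^ka_{j_r}(u)\prod_{r=0}^kZ^2_{t-\sum_{s=1}^rj_s}.$$ Derivatives in $u$ are derivatives of the sample functions $u\mapsto\tilde X_t(u)^2$.
   Formalization: Uniqueness of the solution of the differential equation is claimed only among stationary processes with finite mean (it fails among all processes, e.g. Z=±1, adding c^t); the Volterra series is assumed to hold almost surely simultaneously in u, so that sample derivatives make sense. *)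

theory Defs
  imports "HOL-Probability.Probability"
begin

text \<open>Strict stationarity: shifting time does not change the law of the whole path, taken on the
  product sigma-algebra (equivalently, it does not change the finite-dimensional distributions).\<close>

definition stationary_process :: "'w measure \<Rightarrow> (int \<Rightarrow> 'w \<Rightarrow> real) \<Rightarrow> bool" where
  "stationary_process M Y \<longleftrightarrow>
     (\<forall>t. Y t \<in> borel_measurable M) \<and>
     (\<forall>h. distr M (\<Pi>\<^sub>M t\<in>UNIV. borel) (\<lambda>\<omega> t. Y (t + h) \<omega>) =
          distr M (\<Pi>\<^sub>M t\<in>UNIV. borel) (\<lambda>\<omega> t. Y t \<omega>))"

definition arch_equation ::
  "'w measure \<Rightarrow> (int \<Rightarrow> 'w \<Rightarrow> real) \<Rightarrow> (nat \<Rightarrow> real \<Rightarrow> real) \<Rightarrow> real \<Rightarrow> (int \<Rightarrow> 'w \<Rightarrow> real) \<Rightarrow> bool"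
where
  "arch_equation M Z a u Y \<longleftrightarrow>
     (\<exists>\<sigma>. (\<forall>t. \<sigma> t \<in> borel_measurable M) \<and>
        (AE \<omega> in M. \<forall>t.
           Y t \<omega> = \<sigma> t \<omega> * Z t \<omega> \<and>
           (\<lambda>j. a j u * (Y (t - int j) \<omega>)\<^sup>2) summable_on {1..} \<and>
           (\<sigma> t \<omega>)\<^sup>2 = a 0 u + (\<Sum>\<^sub>\<infinity>j\<in>{1..}. a j u * (Y (t - int j) \<omega>)\<^sup>2)))"

definition volterra_series ::
  "(int \<Rightarrow> 'w \<Rightarrow> real) \<Rightarrow> (nat \<Rightarrow> real \<Rightarrow> real) \<Rightarrow> real \<Rightarrow> int \<Rightarrow> 'w \<Rightarrow> real"
where
  "volterra_series Z a u t \<omega> =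
     a 0 u * (Z t \<omega>)\<^sup>2 +
     (\<Sum>\<^sub>\<infinity>k\<in>{1::nat..}. \<Sum>\<^sub>\<infinity>j\<in>{1..k} \<rightarrow>\<^sub>E {1..}.
        a 0 u * (\<Prod>r=1..k. a (j r) u) * (\<Prod>r=0..k. (Z (t - int (\<Sum>s=1..r. j s)) \<omega>)\<^sup>2))"

text \<open>\<open>X u t \<omega>\<close> is the value at time \<open>t\<close> of the stationary process at \<open>u\<close>. Differentiating the
  sample functions \<open>u \<mapsto> (X u t \<omega>)\<^sup>2\<close> is only meaningful for a suitable version of the family, so the
  exceptional null set of the Volterra representation must not depend on \<open>u\<close>.\<close>

definition stationary_arch ::
  "'w measure \<Rightarrow> (int \<Rightarrow> 'w \<Rightarrow> real) \<Rightarrow> (nat \<Rightarrow> real \<Rightarrow> real) \<Rightarrow> (real \<Rightarrow> int \<Rightarrow> 'w \<Rightarrow> real) \<Rightarrow> bool"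
where
  "stationary_arch M Z a X \<longleftrightarrow>
     (\<forall>u\<in>{0..1}. stationary_process M (X u) \<and> arch_equation M Z a u (X u)) \<and>
     (AE \<omega> in M. \<forall>u\<in>{0..1}. \<forall>t. (X u t \<omega>)\<^sup>2 = volterra_series Z a u t \<omega>)"

text \<open>\<open>D\<close> is only required to agree almost surely with the pathwise derivative: on the exceptional
  null set the latter need not be measurable.\<close>

definition sq_deriv_process ::
  "'w measure \<Rightarrow> (real \<Rightarrow> int \<Rightarrow> 'w \<Rightarrow> real) \<Rightarrow> nat \<Rightarrow> real \<Rightarrow> (int \<Rightarrow> 'w \<Rightarrow> real) \<Rightarrow> bool"
where
  "sq_deriv_process M X i u D \<longleftrightarrow>
     (AE \<omega> in M. \<forall>t. (deriv ^^ i) (\<lambda>v. (X v t \<omega>)\<^sup>2) u = D t \<omega>)"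

text \<open>Solutions are not unique among all processes: if \<open>(Z t)\<^sup>2 = 1\<close> and \<open>a 1 u = c > 0\<close> is the only
  non-zero coefficient with positive index, then \<open>\<lambda>t \<omega>. c powi t\<close> solves the homogeneous equation. Uniqueness is
  therefore understood among stationary processes with finite first moment.\<close>

definition derivative_equation ::
  "'w measure \<Rightarrow> (int \<Rightarrow> 'w \<Rightarrow> real) \<Rightarrow> (nat \<Rightarrow> real \<Rightarrow> real) \<Rightarrow> (nat \<Rightarrow> real \<Rightarrow> real) \<Rightarrow>
   (real \<Rightarrow> int \<Rightarrow> 'w \<Rightarrow> real) \<Rightarrow> real \<Rightarrow> (int \<Rightarrow> 'w \<Rightarrow> real) \<Rightarrow> bool"
where
  "derivative_equation M Z a a' X u Y \<longleftrightarrow>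
     (AE \<omega> in M. \<forall>t.
        (\<lambda>j. a' j u * (X u (t - int j) \<omega>)\<^sup>2) summable_on {1..} \<and>
        (\<lambda>j. a j u * Y (t - int j) \<omega>) summable_on {1..} \<and>
        Y t \<omega> = (a' 0 u + (\<Sum>\<^sub>\<infinity>j\<in>{1..}. a' j u * (X u (t - int j) \<omega>)\<^sup>2)
                        + (\<Sum>\<^sub>\<infinity>j\<in>{1..}. a j u * Y (t - int j) \<omega>)) * (Z t \<omega>)\<^sup>2)"

end

theory Submission
  imports Defs "HOL-Library.Nat_Bijection"
begin

text \<open>
  Write \<open>z s\<close> for the squared innovation at time \<open>s\<close> and list the lags of a Volterra term from the
  present into the past. Collecting the terms of all orders turns the Volterra series into one
  unconditional sum over all finite lists of lags,
  \<open>(X v t)\<^sup>2 = z t * (\<Sum>js. kernel js v * path_weight t js)\<close>, in which the parameter enters only through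
  the deterministic kernels \<open>a\<^sub>0 * a\<^sub>j\<^sub>1 * \<dots>\<close> and chance only through the product of the squared
  innovations at the visited times. These times are distinct, so every path weight has mean one.

  An \<open>i\<close>-th derivative of a kernel of order \<open>n\<close> is at most a constant times \<open>(n + 1) ^ i\<close> times
  the product of the bounds \<open>q j = Q / l j\<close>. As the bounds \<open>q j\<close> with \<open>j \<ge> 1\<close> sum to less than one and
  \<open>j * q j\<close> is summable, there remains room for a small tilt: the numbers \<open>(1 + \<epsilon> * j) * q j\<close>
  still sum to less than one. Their products over lists are summable (a geometric series), they
  absorb the polynomial factors \<open>(n + 1) ^ 3\<close>, and they absorb the total lag of a path as well. Hence
  almost surely, simultaneously for all times, the tilted products times the path weights are summable
  (\<open>AE_regular\<close>). This event is the same for every parameter, and on it the analysis is carried out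
  path by path:

  \<^item> the series may be differentiated three times term by term, uniformly in the parameter
    (\<open>iterated_deriv_eq_kernel_series\<close>); the derivatives are measurable, shift equivariant functions
    of the innovations and therefore stationary;

  \<^item> splitting off the first lag, and applying Leibniz' rule to the kernel, yields the differentiated
    equation (\<open>kernel_series_1_equation\<close>);

  \<^item> the difference \<open>y\<close> of two solutions solves the homogeneous equation. Since a competing
    solution need not be a function of the past innovations, moments of products with it are
    not available; but a stationary integrable sequence grows at most linearly along almost every
    path (\<open>stationary_integrable_growth\<close>). After iterating the homogeneous equation \<open>k\<close> times,
    \<open>y\<close> is bounded, up to a factor depending on the path, by the sum over the lists of length \<open>k\<close> of
    the product of the coefficient bounds, the path weight and one plus the total lag. This is one block of a convergent series, so it tends to zero
    (\<open>homogeneous_solution_zero\<close>).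
\<close>

section \<open>Summation over lists\<close>

lemma summable_on_dominated:
  fixes f g :: "'a \<Rightarrow> real"
  assumes "g summable_on S" "\<And>x. x \<in> S \<Longrightarrow> \<bar>f x\<bar> \<le> g x"
  shows "f summable_on S"
  using Infinite_Sum.abs_summable_on_comparison_test'[OF assms(1), of f] assms(2)
  by (auto intro: Infinite_Sum.abs_summable_summable)

lemma abs_infsum_le:
  fixes f g :: "'a \<Rightarrow> real"
  assumes "g summable_on S" "\<And>x. x \<in> S \<Longrightarrow> \<bar>f x\<bar> \<le> g x"
  shows "\<bar>infsum f S\<bar> \<le> infsum g S"
  using norm_infsum_le[OF has_sum_infsum[OF summable_on_dominated[OF assms]] has_sum_infsum[OF assms(1)]]
    assms(2) by auto

lemma UNIV_list_Cons: "(UNIV :: 'a list set) = insert [] (case_prod Cons ` UNIV)"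
proof -
  have "x \<in> insert [] (case_prod Cons ` UNIV)" for x :: "'a list"
    by (cases x) (auto simp: image_iff)
  then show ?thesis by auto
qed

lemma inj_case_prod_Cons: "inj (case_prod Cons)"
  by (auto simp: inj_on_def)

lemma summable_on_list_Cons:
  fixes f :: "'a list \<Rightarrow> real"
  assumes "f summable_on UNIV"
  shows "(\<lambda>(j, js). f (j # js)) summable_on UNIV"
proof -
  have "f summable_on (case_prod Cons ` UNIV)"
    using assms by (rule summable_on_subset) auto
  then show ?thesis
    by (subst (asm) summable_on_reindex[OF inj_case_prod_Cons]) (simp add: o_def case_prod_unfold)
qed

lemma infsum_list_Cons:
  fixes f :: "'a list \<Rightarrow> real"
  assumes "f summable_on UNIV"
  shows "infsum f UNIV = f [] + (\<Sum>\<^sub>\<infinity>j. \<Sum>\<^sub>\<infinity>js. f (j # js))"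
proof -
  have s: "f summable_on (case_prod Cons ` UNIV)"
    using assms by (rule summable_on_subset) auto
  have "infsum f UNIV = f [] + infsum f (case_prod Cons ` UNIV)"
    by (subst UNIV_list_Cons, subst infsum_insert[OF s]) auto
  also have "infsum f (case_prod Cons ` UNIV) = infsum (\<lambda>(j, js). f (j # js)) (UNIV \<times> UNIV)"
    by (subst infsum_reindex[OF inj_case_prod_Cons]) (simp add: o_def case_prod_unfold)
  also have "\<dots> = (\<Sum>\<^sub>\<infinity>j. \<Sum>\<^sub>\<infinity>js. f (j # js))"
    using summable_on_list_Cons[OF assms]
    by (subst infsum_Sigma'_banach[of "\<lambda>j js. f (j # js)" UNIV "\<lambda>_. UNIV"]) auto
  finally show ?thesis .
qed

lemma infsum_length_Suc:
  fixes f :: "'a list \<Rightarrow> real"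
  assumes "f summable_on UNIV"
  shows "infsum f {js. length js = Suc k} = (\<Sum>\<^sub>\<infinity>j. \<Sum>\<^sub>\<infinity>js | length js = k. f (j # js))"
proof -
  have eq: "{js. length js = Suc k} = case_prod Cons ` (UNIV \<times> {js :: 'a list. length js = k})"
    by (auto simp: image_iff length_Suc_conv)
  have inj: "inj_on (case_prod Cons) (UNIV \<times> {js :: 'a list. length js = k})"
    by (auto simp: inj_on_def)
  have s: "(\<lambda>(j, js). f (j # js)) summable_on (UNIV \<times> {js :: 'a list. length js = k})"
    using summable_on_list_Cons[OF assms] by (rule summable_on_subset) auto
  have "infsum f {js. length js = Suc k}
      = infsum (\<lambda>(j, js). f (j # js)) (UNIV \<times> {js. length js = k})"
    unfolding eq by (subst infsum_reindex[OF inj]) (simp add: o_def case_prod_unfold)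
  also have "\<dots> = (\<Sum>\<^sub>\<infinity>j. \<Sum>\<^sub>\<infinity>js | length js = k. f (j # js))"
    by (subst infsum_Sigma'_banach[OF s]) auto
  finally show ?thesis .
qed

lemma lists_eq_Sigma_length:
  "(UNIV :: 'a list set) = snd ` (SIGMA k:UNIV. {js :: 'a list. length js = k})"
  by (auto simp: image_iff)

lemma
  fixes f :: "'a list \<Rightarrow> real"
  assumes "f summable_on UNIV"
  shows summable_on_infsum_length: "(\<lambda>k. \<Sum>\<^sub>\<infinity>js | length js = k. f js) summable_on UNIV"
    and infsum_by_length: "infsum f UNIV = (\<Sum>\<^sub>\<infinity>k. \<Sum>\<^sub>\<infinity>js | length js = k. f js)"
proof -
  let ?S = "SIGMA k:UNIV. {js :: 'a list. length js = k}"
  have inj: "inj_on snd ?S" by (auto simp: inj_on_def)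
  have s: "(\<lambda>(k, js). f js) summable_on ?S"
    using assms unfolding lists_eq_Sigma_length
    by (subst (asm) summable_on_reindex[OF inj]) (simp add: o_def case_prod_unfold)
  show "(\<lambda>k. \<Sum>\<^sub>\<infinity>js | length js = k. f js) summable_on UNIV"
    using summable_on_Sigma_banach[OF s] .
  have "infsum f UNIV = infsum (\<lambda>(k, js). f js) ?S"
    unfolding lists_eq_Sigma_length
    by (subst infsum_reindex[OF inj]) (simp add: o_def case_prod_unfold)
  also have "\<dots> = (\<Sum>\<^sub>\<infinity>k. \<Sum>\<^sub>\<infinity>js | length js = k. f js)"
    by (rule infsum_Sigma'_banach[OF s, symmetric])
  finally show "infsum f UNIV = (\<Sum>\<^sub>\<infinity>k. \<Sum>\<^sub>\<infinity>js | length js = k. f js)" .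
qed

text \<open>Multinomial expansion of a power: a list of length \<open>k\<close> chooses one summand from each of \<open>k\<close> equal
  factors.\<close>

lemma sum_prod_list_length:
  fixes b :: "'a \<Rightarrow> 'b :: comm_semiring_1"
  assumes "finite A"
  shows "(\<Sum>js | set js \<subseteq> A \<and> length js = k. prod_list (map b js)) = (\<Sum>j\<in>A. b j) ^ k"
proof (induction k)
  case 0
  have "{js. set js \<subseteq> A \<and> length js = 0} = {[]}" by auto
  then show ?case by simp
next
  case (Suc k)
  let ?L = "{js. set js \<subseteq> A \<and> length js = k}"
  have eq: "{js. set js \<subseteq> A \<and> length js = Suc k} = case_prod Cons ` (A \<times> ?L)"
    by (auto simp: image_iff length_Suc_conv)
  have inj: "inj_on (case_prod Cons) (A \<times> ?L)" by (auto simp: inj_on_def)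
  have "(\<Sum>js | set js \<subseteq> A \<and> length js = Suc k. prod_list (map b js))
      = (\<Sum>(j, js)\<in>A \<times> ?L. b j * prod_list (map b js))"
    unfolding eq by (subst sum.reindex[OF inj]) (simp add: o_def case_prod_unfold)
  also have "\<dots> = (\<Sum>j\<in>A. b j) * (\<Sum>js\<in>?L. prod_list (map b js))"
    by (simp add: sum_product sum.cartesian_product)
  finally show ?case using Suc by simp
qed

lemma prod_list_nonneg_real:
  "(\<And>x. x \<in> set xs \<Longrightarrow> 0 \<le> (x::real)) \<Longrightarrow> 0 \<le> prod_list xs"
  by (induction xs) auto

text \<open>Grouping the lists by length bounds every finite partial sum by the geometric series of
  the total mass of \<open>b\<close>.\<close>

lemma summable_on_prod_list:
  fixes b :: "nat \<Rightarrow> real"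
  assumes nonneg: "\<And>j. 0 \<le> b j" and summ: "b summable_on UNIV" and less: "infsum b UNIV < 1"
  shows "(\<lambda>js. prod_list (map b js)) summable_on UNIV"
proof (rule nonneg_bdd_above_summable_on)
  let ?P = "\<lambda>js. prod_list (map b js)"
  have P0: "0 \<le> ?P js" for js
    by (rule prod_list_nonneg_real) (auto simp: nonneg)
  then show "0 \<le> ?P js" for js .
  define \<beta> where "\<beta> = infsum b UNIV"
  have \<beta>: "0 \<le> \<beta>" "\<beta> < 1" using less by (auto simp: \<beta>_def intro: infsum_nonneg nonneg)
  show "bdd_above (sum ?P ` {F. F \<subseteq> UNIV \<and> finite F})"
  proof (rule bdd_aboveI2)
    fix F :: "nat list set"
    assume "F \<in> {F. F \<subseteq> UNIV \<and> finite F}"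
    then have F: "finite F" by simp
    define A where "A = \<Union>(set ` F)"
    define N where "N = Suc (Max (insert 0 (length ` F)))"
    have A: "finite A" using F by (auto simp: A_def)
    have len: "length js < N" if "js \<in> F" for js
      using that F by (auto simp: N_def less_Suc_eq_le intro!: Max_ge)
    let ?L = "\<lambda>k. {js. set js \<subseteq> A \<and> length js = k}"
    have fin: "finite (\<Union>k<N. ?L k)" using A by (auto intro: finite_lists_length_eq)
    have "sum ?P F \<le> sum ?P (\<Union>k<N. ?L k)"
      by (rule sum_mono2[OF fin]) (use len P0 in \<open>auto simp: A_def\<close>)
    also have "\<dots> = (\<Sum>k<N. sum ?P (?L k))"
      by (rule sum.UNION_disjoint) (use A in \<open>auto intro: finite_lists_length_eq\<close>)
    also have "\<dots> = (\<Sum>k<N. (\<Sum>j\<in>A. b j) ^ k)"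
      by (intro sum.cong refl sum_prod_list_length A)
    also have "\<dots> \<le> (\<Sum>k<N. \<beta> ^ k)"
      unfolding \<beta>_def
      by (intro sum_mono power_mono finite_sum_le_infsum summ A sum_nonneg nonneg) auto
    also have "\<dots> \<le> 1 / (1 - \<beta>)"
      using \<beta> sum_le_suminf[of "\<lambda>k. \<beta> ^ k" "{..<N}"]
      by (simp add: summable_geometric suminf_geometric)
    finally show "sum ?P F \<le> 1 / (1 - \<beta>)" .
  qed
qed

lemma summable_on_list_iff_summable:
  fixes f :: "nat list \<Rightarrow> real"
  assumes "\<And>js. 0 \<le> f js"
  shows "f summable_on UNIV \<longleftrightarrow> summable (\<lambda>n. f (list_decode n))"
  using summable_on_reindex_bij_betw[OF bij_list_decode, of f] assms
  by (simp add: summable_on_UNIV_nonneg_real_iff)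

lemma bij_betw_Suc_UNIV: "bij_betw Suc UNIV {1..}"
proof -
  have "{1..} = range Suc" by (auto simp: image_iff) (metis Suc_le_D)
  then show ?thesis by (simp add: bij_betw_def)
qed

lemmas summable_on_from_1 = summable_on_reindex_bij_betw[OF bij_betw_Suc_UNIV]
lemmas infsum_from_1 = infsum_reindex_bij_betw[OF bij_betw_Suc_UNIV]

section \<open>Termwise differentiation\<close>

text \<open>The domination is that of the Weierstrass M-test, so that the theorem on termwise differentiation of
  sequences of functions applies once the index type has been enumerated.\<close>

lemma has_real_derivative_infsum:
  fixes f f' :: "'a :: countable \<Rightarrow> real \<Rightarrow> real"
  assumes S: "convex S"
    and deriv: "\<And>x u. u \<in> S \<Longrightarrow> (f x has_real_derivative f' x u) (at u within S)"
    and summ: "g summable_on UNIV"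
    and bound: "\<And>x u. u \<in> S \<Longrightarrow> \<bar>f x u\<bar> \<le> g x"
    and bound': "\<And>x u. u \<in> S \<Longrightarrow> \<bar>f' x u\<bar> \<le> g x"
    and u: "u \<in> S"
  shows "((\<lambda>v. \<Sum>\<^sub>\<infinity>x. f x v) has_real_derivative (\<Sum>\<^sub>\<infinity>x. f' x u)) (at u within S)"
proof -
  \<comment> \<open>The injection into the naturals need not be surjective; unused indices carry the zero function.\<close>
  define ext where "ext h = (\<lambda>n. if n \<in> range (to_nat :: 'a \<Rightarrow> nat) then h (from_nat n) else (0::real))"
    for h :: "'a \<Rightarrow> real"
  have ext_sums: "ext h sums infsum h UNIV" if "\<And>x. \<bar>h x\<bar> \<le> g x" for h
  proof -
    have "(h has_sum infsum h UNIV) UNIV"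
      using summable_on_dominated[OF summ, of h] that by (intro has_sum_infsum) auto
    also have "?this \<longleftrightarrow> (ext h has_sum infsum h UNIV) (range (to_nat :: 'a \<Rightarrow> nat))"
      by (subst has_sum_reindex) (auto simp: o_def ext_def)
    also have "\<dots> \<longleftrightarrow> (ext h has_sum infsum h UNIV) UNIV"
      by (rule has_sum_cong_neutral) (auto simp: ext_def)
    finally show ?thesis by (rule has_sum_imp_sums)
  qed
  have g0: "0 \<le> g x" for x using bound[OF u, of x] by linarith
  have sg: "summable (ext g)" using ext_sums[of g] g0 by (auto simp: sums_iff)
  have 1: "\<exists>F. \<forall>v\<in>S. (\<lambda>n. ext (\<lambda>x. f x v) n) sums F v \<and>
      (F has_field_derivative (\<Sum>n. ext (\<lambda>x. f' x v) n)) (at v within S)"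
  proof (rule has_field_derivative_series[OF S _ _ u])
    show "((\<lambda>v. ext (\<lambda>x. f x v) n) has_field_derivative ext (\<lambda>x. f' x v) n) (at v within S)"
      if "v \<in> S" for n v
      using deriv[OF that] by (auto simp: ext_def)
    show "uniform_limit S (\<lambda>n v. \<Sum>i<n. ext (\<lambda>x. f' x v) i) (\<lambda>v. \<Sum>n. ext (\<lambda>x. f' x v) n) sequentially"
      by (rule Weierstrass_m_test[OF _ sg]) (use bound' g0 in \<open>auto simp: ext_def\<close>)
    show "summable (\<lambda>n. ext (\<lambda>x. f x u) n)"
      using ext_sums[of "\<lambda>x. f x u"] bound[OF u] by (auto simp: sums_iff)
  qed
  then obtain F where F: "\<And>v. v \<in> S \<Longrightarrow> (\<lambda>n. ext (\<lambda>x. f x v) n) sums F v"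
    "\<And>v. v \<in> S \<Longrightarrow> (F has_field_derivative (\<Sum>n. ext (\<lambda>x. f' x v) n)) (at v within S)"
    by blast
  have Feq: "F v = (\<Sum>\<^sub>\<infinity>x. f x v)" if "v \<in> S" for v
    using F(1)[OF that] ext_sums[of "\<lambda>x. f x v"] bound[OF that] sums_unique2 by blast
  have F'eq: "(\<Sum>n. ext (\<lambda>x. f' x u) n) = (\<Sum>\<^sub>\<infinity>x. f' x u)"
    using ext_sums[of "\<lambda>x. f' x u"] bound'[OF u] by (auto simp: sums_iff)
  show ?thesis
    using has_field_derivative_transform_within[OF F(2)[OF u] zero_less_one u] Feq F'eq by auto
qed

section \<open>The Volterra series as a sum over lists of lags\<close>

text \<open>Entry \<open>j\<close> of a list stands for the lag \<open>Suc j\<close>, so that lists over all naturals encode exactly the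
  tuples of positive lags. The weight omits the factor at the starting time itself: the sums that
  appear inside the differentiated equation carry the factor \<open>z t\<close> outside, and they must converge
  even where \<open>z t = 0\<close>.\<close>

primrec path_weight :: "(int \<Rightarrow> real) \<Rightarrow> int \<Rightarrow> nat list \<Rightarrow> real" where
  "path_weight z t [] = 1"
| "path_weight z t (j # js) = z (t - int (Suc j)) * path_weight z (t - int (Suc j)) js"

text \<open>The \<open>i\<close>-th derivative of the product of \<open>a\<^sub>0\<close> and the coefficients at the listed lags, with \<open>da i j\<close> as
  the \<open>i\<close>-th derivative of the \<open>j\<close>-th coefficient. Leibniz' rule is taken as the definition because
  the bound on the kernel and the equation for the first derivative both follow its recursion.\<close>

primrec kernel :: "(nat \<Rightarrow> nat \<Rightarrow> real \<Rightarrow> real) \<Rightarrow> nat list \<Rightarrow> nat \<Rightarrow> real \<Rightarrow> real" where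
  "kernel da [] i u = da i 0 u"
| "kernel da (j # js) i u =
     (\<Sum>m\<le>i. real (i choose m) * da m (Suc j) u * kernel da js (i - m) u)"

lemma path_weight_nonneg: "(\<And>s. 0 \<le> z s) \<Longrightarrow> 0 \<le> path_weight z t js"
  by (induction js arbitrary: t) auto

lemma path_weight_shift: "path_weight (\<lambda>s. z (s + h)) t js = path_weight z (t + h) js"
  by (induction js arbitrary: t) (auto simp: algebra_simps)

lemma kernel_0: "kernel da js 0 u = da 0 0 u * prod_list (map (\<lambda>j. da 0 (Suc j) u) js)"
  by (induction js) auto

lemma prod_partial_sums_eq_path_weight:
  "(\<Prod>r\<le>length js. z (t - int (\<Sum>s<r. Suc (js ! s)))) = z t * path_weight z t js"
proof (induction js arbitrary: t)
  case Nil
  show ?case by simp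
next
  case (Cons j js)
  have "(\<Prod>r\<le>length (j # js). z (t - int (\<Sum>s<r. Suc ((j # js) ! s))))
      = z t * (\<Prod>r\<le>length js. z (t - int (\<Sum>s<Suc r. Suc ((j # js) ! s))))"
    by (simp only: list.size(4) add.right_neutral add_Suc_right prod.atMost_Suc_shift) simp
  also have "(\<Prod>r\<le>length js. z (t - int (\<Sum>s<Suc r. Suc ((j # js) ! s))))
      = (\<Prod>r\<le>length js. z ((t - int (Suc j)) - int (\<Sum>s<r. Suc (js ! s))))"
    by (intro prod.cong refl arg_cong[of _ _ z]) (simp only: sum.lessThan_Suc_shift, simp)
  finally show ?case by (simp only: Cons path_weight.simps)
qed

text \<open>Lists of length \<open>k\<close> correspond to the maps from \<open>{1..k}\<close> to the positive integers; unconditional summability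
  permits summing the orders one after the other.\<close>

lemma volterra_series_eq_kernel_series:
  assumes "(\<lambda>js. kernel da js 0 u * path_weight (\<lambda>s. (Z s \<omega>)\<^sup>2) t js) summable_on UNIV"
  shows "volterra_series Z (da 0) u t \<omega> =
    (Z t \<omega>)\<^sup>2 * (\<Sum>\<^sub>\<infinity>js. kernel da js 0 u * path_weight (\<lambda>s. (Z s \<omega>)\<^sup>2) t js)"
proof -
  define z where "z = (\<lambda>s. (Z s \<omega>)\<^sup>2)"
  define F where "F js = z t * (kernel da js 0 u * path_weight z t js)" for js
  have F: "F summable_on UNIV"
    unfolding F_def z_def by (intro summable_on_cmult_right assms)
  define lags where "lags k js = (\<lambda>r\<in>{1..k}. Suc (js ! (r - 1)))" for k and js :: "nat list"
  define G where "G k j = da 0 0 u * (\<Prod>r=1..k. da 0 (j r) u) * (\<Prod>r=0..k. z (t - int (\<Sum>s=1..r. j s)))"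
    for k and j :: "nat \<Rightarrow> nat"
  have G_lags: "G k (lags k js) = F js" if "length js = k" for k js
  proof -
    have "(\<Prod>r=1..k. da 0 (lags k js r) u) = (\<Prod>r<k. da 0 (Suc (js ! r)) u)"
      by (simp add: prod.atLeast1_atMost_eq lags_def)
    also have "\<dots> = prod_list (map (\<lambda>j. da 0 (Suc j) u) js)"
      using that by (simp add: prod.list_conv_set_nth lessThan_atLeast0)
    finally have 1: "da 0 0 u * (\<Prod>r=1..k. da 0 (lags k js r) u) = kernel da js 0 u"
      by (simp add: kernel_0)
    have "(\<Prod>r=0..k. z (t - int (\<Sum>s=1..r. lags k js s)))
        = (\<Prod>r\<le>length js. z (t - int (\<Sum>s<r. Suc (js ! s))))"
    proof (intro prod.cong arg_cong[of _ _ z] arg_cong2[of _ _ _ _ "(-)"] arg_cong[of _ _ int] refl)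
      show "{0..k} = {..length js}" using that by auto
      fix r assume "r \<in> {..length js}"
      then show "(\<Sum>s=1..r. lags k js s) = (\<Sum>s<r. Suc (js ! s))"
        using that by (simp only: One_nat_def sum.atLeast1_atMost_eq) (auto simp: lags_def intro!: sum.cong)
    qed
    also have "\<dots> = z t * path_weight z t js" by (rule prod_partial_sums_eq_path_weight)
    finally show ?thesis using 1 by (simp add: G_def F_def)
  qed
  have inner: "(\<Sum>\<^sub>\<infinity>j\<in>{1..k} \<rightarrow>\<^sub>E {1..}. G k j) = (\<Sum>\<^sub>\<infinity>js | length js = k. F js)" for k
  proof (rule infsum_reindex_bij_witness[symmetric,
        where j = "lags k" and i = "\<lambda>j. map (\<lambda>r. j (Suc r) - 1) [0..<k]"])
    fix js assume js: "js \<in> {js :: nat list. length js = k}"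
    show "map (\<lambda>r. lags k js (Suc r) - 1) [0..<k] = js"
      using js by (auto simp: lags_def intro!: nth_equalityI)
    show "lags k js \<in> {1..k} \<rightarrow>\<^sub>E {1..}"
      by (auto simp: lags_def)
    show "G k (lags k js) = F js" using G_lags[of js k] js by blast
  next
    fix j :: "nat \<Rightarrow> nat" assume j: "j \<in> {1..k} \<rightarrow>\<^sub>E {1..}"
    have j1: "1 \<le> j r" if "1 \<le> r" "r \<le> k" for r
      using PiE_mem[OF j, of r] that by auto
    show "lags k (map (\<lambda>r. j (Suc r) - 1) [0..<k]) = j"
    proof
      fix r
      show "lags k (map (\<lambda>r. j (Suc r) - 1) [0..<k]) r = j r"
        using j1[of r] PiE_arb[OF j, of r] by (auto simp: lags_def restrict_def)
    qed
    show "map (\<lambda>r. j (Suc r) - 1) [0..<k] \<in> {js. length js = k}" by simp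
  qed
  let ?s = "\<lambda>k. \<Sum>\<^sub>\<infinity>js | length js = k. F js"
  have "volterra_series Z (da 0) u t \<omega> = da 0 0 u * z t + (\<Sum>\<^sub>\<infinity>k\<in>{1..}. ?s k)"
    unfolding volterra_series_def inner[symmetric] G_def z_def by simp
  also have "da 0 0 u * z t = ?s 0"
    by (simp add: F_def)
  also have "?s 0 + (\<Sum>\<^sub>\<infinity>k\<in>{1..}. ?s k) = (\<Sum>\<^sub>\<infinity>k\<in>insert 0 {1..}. ?s k)"
    by (rule infsum_insert[symmetric])
      (auto intro!: summable_on_subset[OF summable_on_infsum_length[OF F]])
  also have "insert 0 {1::nat..} = UNIV" by auto
  also have "(\<Sum>\<^sub>\<infinity>k. ?s k) = infsum F UNIV"
    by (rule infsum_by_length[OF F, symmetric])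
  also have "\<dots> = z t * (\<Sum>\<^sub>\<infinity>js. kernel da js 0 u * path_weight z t js)"
    unfolding F_def by (rule infsum_cmult_right') 
  finally show ?thesis by (simp add: z_def)
qed

section \<open>Domination and pathwise differentiation\<close>

text \<open>The number \<open>q j\<close> plays the role of \<open>Q / l j\<close>. The last two assumptions are what contraction together with a
  finite first moment of the lag weights provides: the weights remain subcritical after the tilt
  by \<open>1 + \<epsilon> * j\<close>.\<close>

locale smooth_coefficients =
  fixes da :: "nat \<Rightarrow> nat \<Rightarrow> real \<Rightarrow> real" and q :: "nat \<Rightarrow> real" and K \<epsilon> :: real
  assumes has_derivative: "\<And>i j u. i < 3 \<Longrightarrow> u \<in> {0..1} \<Longrightarrow>
      (da i j has_real_derivative da (Suc i) j u) (at u within {0..1})"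
    and coeff_bound: "\<And>i j u. i \<le> 3 \<Longrightarrow> u \<in> {0..1} \<Longrightarrow> \<bar>da i j u\<bar> \<le> K ^ i * q j"
    and K: "1 \<le> K" and \<epsilon>: "0 < \<epsilon>" "\<epsilon> \<le> 1"
    and q: "\<And>j. 0 < q j"
    and tilted_summable: "(\<lambda>j. (1 + \<epsilon> * real (Suc j)) * q (Suc j)) summable_on UNIV"
    and tilted_less: "(\<Sum>\<^sub>\<infinity>j. (1 + \<epsilon> * real (Suc j)) * q (Suc j)) < 1"
begin

definition q_prod :: "nat list \<Rightarrow> real" where
  "q_prod js = prod_list (map (\<lambda>j. q (Suc j)) js)"

definition majorant :: "nat list \<Rightarrow> real" where
  "majorant js = prod_list (map (\<lambda>j. (1 + \<epsilon> * real (Suc j)) * q (Suc j)) js)"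

lemma q_prod_pos: "0 < q_prod js"
  unfolding q_prod_def by (induction js) (auto simp: q)

lemma tilt_pos: "0 < 1 + \<epsilon> * real j"
  using \<epsilon> by (simp add: add_pos_nonneg)

lemma majorant_pos: "0 < majorant js"
  unfolding majorant_def
  by (induction js) (auto intro!: mult_pos_pos q tilt_pos simp del: of_nat_Suc)

lemma majorant_summable: "majorant summable_on UNIV"
  unfolding majorant_def[abs_def]
  by (rule summable_on_prod_list)
    (use tilted_summable tilted_less q tilt_pos in \<open>auto simp: less_imp_le simp del: of_nat_Suc\<close>)

text \<open>Every lag is at least one, so each tilting factor is at least \<open>1 + \<epsilon>\<close>.\<close>

lemma q_prod_power_le_majorant: "(1 + \<epsilon>) ^ length js * q_prod js \<le> majorant js"
proof (induction js)
  case Nil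
  show ?case by (simp add: q_prod_def majorant_def)
next
  case (Cons j js)
  have "(1 + \<epsilon>) ^ length (j # js) * q_prod (j # js)
      = ((1 + \<epsilon>) * q (Suc j)) * ((1 + \<epsilon>) ^ length js * q_prod js)"
    by (simp add: q_prod_def)
  also have "\<dots> \<le> ((1 + \<epsilon> * real (Suc j)) * q (Suc j)) * majorant js"
    using q[of "Suc j"] \<epsilon> q_prod_pos[of js]
    by (intro mult_mono Cons mult_right_mono) (auto simp: less_imp_le)
  also have "\<dots> = majorant (j # js)" by (simp add: majorant_def)
  finally show ?case .
qed

lemma q_prod_sum_le_majorant:
  "(1 + \<epsilon> * real (sum_list (map Suc js))) * q_prod js \<le> majorant js"
proof (induction js)
  case Nil
  show ?case by (simp add: q_prod_def majorant_def)
next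
  case (Cons j js)
  let ?s = "real (sum_list (map Suc js))"
  have "(1 + \<epsilon> * real (sum_list (map Suc (j # js)))) \<le> (1 + \<epsilon> * real (Suc j)) * (1 + \<epsilon> * ?s)"
    using \<epsilon> by (simp add: algebra_simps)
  then have "(1 + \<epsilon> * real (sum_list (map Suc (j # js)))) * q_prod (j # js)
      \<le> ((1 + \<epsilon> * real (Suc j)) * (1 + \<epsilon> * ?s)) * q_prod (j # js)"
    by (rule mult_right_mono) (simp add: q_prod_pos less_imp_le)
  also have "\<dots> = ((1 + \<epsilon> * real (Suc j)) * q (Suc j)) * ((1 + \<epsilon> * ?s) * q_prod js)"
    by (simp add: q_prod_def)
  also have "\<dots> \<le> ((1 + \<epsilon> * real (Suc j)) * q (Suc j)) * majorant js"
    using tilt_pos[of "Suc j"] q[of "Suc j"]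
    by (intro mult_left_mono Cons) (simp add: less_imp_le del: of_nat_Suc)
  also have "\<dots> = majorant (j # js)" by (simp add: majorant_def)
  finally show ?case .
qed

text \<open>The \<open>i\<close> derivatives are distributed over \<open>length js + 1\<close> factors, each of which gains at most a factor \<open>K\<close> per
  derivative; the binomial theorem sums the contributions exactly.\<close>

lemma kernel_bound:
  assumes u: "u \<in> {0..1}" and "i \<le> 3"
  shows "\<bar>kernel da js i u\<bar> \<le> q 0 * (K * (real (length js) + 1)) ^ i * q_prod js"
  using \<open>i \<le> 3\<close>
proof (induction js arbitrary: i)
  case Nil
  then show ?case using coeff_bound[OF Nil u, of 0] by (simp add: q_prod_def mult_ac)
next
  case (Cons j js)
  let ?n = "real (length js) + 1"
  have "\<bar>kernel da (j # js) i u\<bar>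
      \<le> (\<Sum>m\<le>i. real (i choose m) * (K ^ m * q (Suc j)) * (q 0 * (K * ?n) ^ (i - m) * q_prod js))"
    unfolding kernel.simps
  proof (rule order_trans[OF sum_abs sum_mono])
    fix m assume m: "m \<in> {..i}"
    have "\<bar>da m (Suc j) u\<bar> * \<bar>kernel da js (i - m) u\<bar>
        \<le> (K ^ m * q (Suc j)) * (q 0 * (K * ?n) ^ (i - m) * q_prod js)"
      using m Cons.prems K q[of "Suc j"] coeff_bound[OF _ u, of m "Suc j"] Cons.IH[of "i - m"]
      by (intro mult_mono) (auto simp: less_imp_le)
    then show "\<bar>real (i choose m) * da m (Suc j) u * kernel da js (i - m) u\<bar>
        \<le> real (i choose m) * (K ^ m * q (Suc j)) * (q 0 * (K * ?n) ^ (i - m) * q_prod js)"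
      by (simp add: abs_mult mult.assoc mult_left_mono)
  qed
  also have "\<dots> = q 0 * (\<Sum>m\<le>i. real (i choose m) * K ^ m * (K * ?n) ^ (i - m)) * q_prod (j # js)"
    by (simp add: sum_distrib_left sum_distrib_right q_prod_def mult_ac)
  also have "(\<Sum>m\<le>i. real (i choose m) * K ^ m * (K * ?n) ^ (i - m)) = (K + K * ?n) ^ i"
    by (rule binomial_ring[symmetric])
  also have "K + K * ?n = K * (real (length (j # js)) + 1)" by (simp add: algebra_simps)
  finally show ?case .
qed

definition kernel_const :: real where
  "kernel_const = q 0 * (K * (7 / \<epsilon>)) ^ 3"

lemma kernel_const_pos: "0 < kernel_const"
  using q K \<epsilon> by (simp add: kernel_const_def)

lemma kernel_le_majorant:
  assumes u: "u \<in> {0..1}" and i: "i \<le> 3"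
  shows "\<bar>kernel da js i u\<bar> \<le> kernel_const * majorant js"
proof -
  define n where "n = length js"
  \<comment> \<open>Bernoulli's inequality for \<open>(1 + \<delta>) ^ n\<close>, cubed, shows that the exponential beats the cubic
    polynomial; \<open>\<epsilon> / 7\<close> is chosen because \<open>3 * \<delta> + 3 * \<delta>\<^sup>2 + \<delta>\<^sup>3 \<le> 7 * \<delta>\<close> for \<open>\<delta> \<le> 1\<close>.\<close>
  define \<delta> where "\<delta> = \<epsilon> / 7"
  have \<delta>: "0 < \<delta>" "\<delta> \<le> 1" using \<epsilon> by (auto simp: \<delta>_def)
  have "\<delta> ^ 2 \<le> \<delta>" "\<delta> ^ 3 \<le> \<delta>"
    using \<delta> power_decreasing[of 1 2 \<delta>] power_decreasing[of 1 3 \<delta>] by auto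
  moreover have "(1 + \<delta>) ^ 3 = 1 + 3 * \<delta> + 3 * \<delta> ^ 2 + \<delta> ^ 3"
    by (simp add: power2_eq_square power3_eq_cube algebra_simps)
  ultimately have \<delta>3: "(1 + \<delta>) ^ 3 \<le> 1 + \<epsilon>"
    by (simp add: \<delta>_def)
  have "\<delta> * (real n + 1) \<le> 1 + real n * \<delta>" using \<delta> by (simp add: algebra_simps)
  also have "\<dots> \<le> (1 + \<delta>) ^ n" using \<delta> by (intro Bernoulli_inequality) auto
  finally have "(\<delta> * (real n + 1)) ^ 3 \<le> ((1 + \<delta>) ^ n) ^ 3"
    using \<delta> by (intro power_mono) auto
  also have "\<dots> = ((1 + \<delta>) ^ 3) ^ n" by (simp flip: power_mult add: mult.commute)
  also have "\<dots> \<le> (1 + \<epsilon>) ^ n" using \<delta>3 \<delta> by (intro power_mono) auto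
  finally have "(7 / \<epsilon>) ^ 3 * (\<delta> * (real n + 1)) ^ 3 \<le> (7 / \<epsilon>) ^ 3 * (1 + \<epsilon>) ^ n"
    using \<epsilon> by (intro mult_left_mono) auto
  moreover have "(7 / \<epsilon>) * (\<delta> * (real n + 1)) = real n + 1"
    using \<epsilon> by (simp add: \<delta>_def)
  ultimately have n3: "(real n + 1) ^ 3 \<le> (7 / \<epsilon>) ^ 3 * (1 + \<epsilon>) ^ n"
    by (metis power_mult_distrib)
  have "1 * 1 \<le> K * (real n + 1)" using K by (intro mult_mono) auto
  then have "(K * (real n + 1)) ^ i \<le> (K * (real n + 1)) ^ 3"
    using i by (intro power_increasing) auto
  also have "\<dots> \<le> (K * (7 / \<epsilon>)) ^ 3 * (1 + \<epsilon>) ^ n"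
    using mult_left_mono[OF n3, of "K ^ 3"] K by (simp only: power_mult_distrib mult.assoc) simp
  finally have *: "(K * (real n + 1)) ^ i \<le> (K * (7 / \<epsilon>)) ^ 3 * (1 + \<epsilon>) ^ n" .
  have "\<bar>kernel da js i u\<bar> \<le> q 0 * (K * (real n + 1)) ^ i * q_prod js"
    unfolding n_def by (rule kernel_bound[OF u i])
  also have "\<dots> \<le> q 0 * ((K * (7 / \<epsilon>)) ^ 3 * (1 + \<epsilon>) ^ n) * q_prod js"
    using * q[of 0] q_prod_pos[of js] by (intro mult_left_mono mult_right_mono) auto
  also have "\<dots> = kernel_const * ((1 + \<epsilon>) ^ n * q_prod js)" by (simp add: kernel_const_def)
  also have "\<dots> \<le> kernel_const * majorant js"
    unfolding n_def using kernel_const_pos by (intro mult_left_mono q_prod_power_le_majorant) auto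
  finally show ?thesis .
qed

lemma kernel_has_derivative:
  assumes u: "u \<in> {0..1}"
  shows "i < 3 \<Longrightarrow> (kernel da js i has_real_derivative kernel da js (Suc i) u) (at u within {0..1})"
proof (induction js arbitrary: i)
  case Nil
  then show ?case using has_derivative[OF Nil u, of 0] by (simp add: fun_eq_iff[symmetric] kernel.simps(1)[abs_def])
next
  case (Cons j js)
  note d = has_derivative[OF _ u] 
  note [derivative_intros] = d[of 0] d[of "Suc 0"] d[of "Suc (Suc 0)"]
    Cons.IH[of 0] Cons.IH[of "Suc 0"] Cons.IH[of "Suc (Suc 0)"]
  consider "i = 0" | "i = Suc 0" | "i = Suc (Suc 0)" using Cons.prems by linarith
  then show ?case
    by cases (auto intro!: derivative_eq_intros simp: algebra_simps)
qed

text \<open>The event on which every pathwise argument takes place. It does not mention the parameter \<open>u\<close>.\<close>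

definition regular :: "(int \<Rightarrow> real) \<Rightarrow> bool" where
  "regular z \<longleftrightarrow> (\<forall>s. 0 \<le> z s) \<and> (\<forall>t. (\<lambda>js. majorant js * path_weight z t js) summable_on UNIV)"

definition kernel_series :: "(int \<Rightarrow> real) \<Rightarrow> nat \<Rightarrow> real \<Rightarrow> int \<Rightarrow> real" where
  "kernel_series z i u t = (\<Sum>\<^sub>\<infinity>js. kernel da js i u * path_weight z t js)"

context
  fixes z :: "int \<Rightarrow> real"
  assumes reg: "regular z"
begin

lemma z_nonneg: "0 \<le> z s"
  using reg by (simp add: regular_def)

lemma weight_nonneg: "0 \<le> path_weight z t js"
  by (intro path_weight_nonneg z_nonneg)

lemma majorant_weight_summable:
  "(\<lambda>js. c * (majorant js * path_weight z t js)) summable_on UNIV"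
  using reg by (auto simp: regular_def intro: summable_on_cmult_right)

lemma kernel_weight_bound:
  assumes "u \<in> {0..1}" "i \<le> 3"
  shows "\<bar>kernel da js i u * path_weight z t js\<bar> \<le> kernel_const * (majorant js * path_weight z t js)"
  using mult_right_mono[OF kernel_le_majorant[OF assms] weight_nonneg]
  by (simp add: abs_mult weight_nonneg mult.assoc)

lemma kernel_weight_summable:
  assumes "u \<in> {0..1}" "i \<le> 3"
  shows "(\<lambda>js. kernel da js i u * path_weight z t js) summable_on UNIV"
  by (rule summable_on_dominated[OF majorant_weight_summable kernel_weight_bound[OF assms]])

lemma kernel_series_has_derivative:
  assumes u: "u \<in> {0..1}" and i: "i < 3"
  shows "((\<lambda>v. kernel_series z i v t) has_real_derivative kernel_series z (Suc i) u t) (at u within {0..1})"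
  unfolding kernel_series_def
  by (rule has_real_derivative_infsum[OF _ _ majorant_weight_summable[of kernel_const t]])
    (use i u in \<open>auto intro!: kernel_weight_bound DERIV_cmult_right kernel_has_derivative\<close>)

lemma iterated_deriv_eq_kernel_series:
  assumes f: "\<And>v. v \<in> {0..1} \<Longrightarrow> f v = z t * kernel_series z 0 v t"
    and "i \<le> 3" "u \<in> {0<..<1}"
  shows "(deriv ^^ i) f u = z t * kernel_series z i u t"
    and "i < 3 \<Longrightarrow> ((deriv ^^ i) f has_real_derivative z t * kernel_series z (Suc i) u t) (at u)"
proof -
  have step: "((deriv ^^ i) f has_real_derivative z t * kernel_series z (Suc i) u t) (at u)"
    if eq: "\<And>v. v \<in> {0<..<1} \<Longrightarrow> (deriv ^^ i) f v = z t * kernel_series z i v t"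
      and "i < 3" "u \<in> {0<..<1}" for i u
  proof -
    have "((\<lambda>v. z t * kernel_series z i v t) has_real_derivative z t * kernel_series z (Suc i) u t)
        (at u within {0..1})"
      using that by (intro DERIV_cmult kernel_series_has_derivative) auto
    moreover have "at u within {0..1} = at u"
      using that by (intro at_within_interior) (simp add: interior_atLeastAtMost_real)
    ultimately have "((\<lambda>v. z t * kernel_series z i v t) has_real_derivative
        z t * kernel_series z (Suc i) u t) (at u)"
      by simp
    then show ?thesis
      by (rule has_field_derivative_transform_within_open[of _ _ _ "{0<..<1}"]) (use that in auto)
  qed
  have main: "(deriv ^^ i) f u = z t * kernel_series z i u t" if "i \<le> 3" "u \<in> {0<..<1}" for i u
    using that
  proof (induction i arbitrary: u)
    case 0
    then show ?case using f[of u] by simp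
  next
    case (Suc i)
    then have "((deriv ^^ i) f has_real_derivative z t * kernel_series z (Suc i) u t) (at u)"
      by (intro step) auto
    then show ?case by (simp add: DERIV_imp_deriv)
  qed
  show "(deriv ^^ i) f u = z t * kernel_series z i u t"
    using main assms by blast
  show "((deriv ^^ i) f has_real_derivative z t * kernel_series z (Suc i) u t) (at u)" if "i < 3"
    using step[OF main that] that assms by auto
qed

end

end

section \<open>The differentiated equation and its uniqueness\<close>

context smooth_coefficients
begin

text \<open>The terms are dominated by the majorant of the prolonged list \<open>j # js\<close>, which is summable over all
  pairs. This is the summability behind every exchange of the first lag with the remaining ones.\<close>

lemma shifted_kernel_summable:
  assumes reg: "regular z" and u: "u \<in> {0..1}" and m: "m \<le> 3" and i: "i \<le> 3"
  shows "(\<lambda>(j, js). da m (Suc j) u *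
    (z (t - int (Suc j)) * (kernel da js i u * path_weight z (t - int (Suc j)) js))) summable_on UNIV"
proof -
  let ?A = "\<lambda>(j, js). K ^ m * kernel_const * (majorant (j # js) * path_weight z t (j # js))"
  have A: "?A summable_on UNIV"
    by (rule summable_on_list_Cons) (rule majorant_weight_summable[OF reg])
  show ?thesis
  proof (rule summable_on_dominated[OF A], clarsimp simp del: of_nat_Suc)
    fix j js
    let ?w = "z (t - int (Suc j)) * path_weight z (t - int (Suc j)) js"
    have w: "0 \<le> ?w" by (simp add: z_nonneg[OF reg] weight_nonneg[OF reg])
    have "q (Suc j) \<le> (1 + \<epsilon> * real (Suc j)) * q (Suc j)"
      using \<epsilon> q[of "Suc j"] by (simp add: algebra_simps del: of_nat_Suc)
    then have "K ^ m * q (Suc j) \<le> K ^ m * ((1 + \<epsilon> * real (Suc j)) * q (Suc j))"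
      using K by (intro mult_left_mono) auto
    with coeff_bound[OF m u, of "Suc j"]
    have "\<bar>da m (Suc j) u\<bar> \<le> K ^ m * ((1 + \<epsilon> * real (Suc j)) * q (Suc j))" by linarith
    then have "\<bar>da m (Suc j) u\<bar> * \<bar>kernel da js i u\<bar>
        \<le> (K ^ m * ((1 + \<epsilon> * real (Suc j)) * q (Suc j))) * (kernel_const * majorant js)"
      by (intro mult_mono kernel_le_majorant[OF u i]) auto
    then have "\<bar>da m (Suc j) u\<bar> * \<bar>kernel da js i u\<bar> * ?w
        \<le> (K ^ m * ((1 + \<epsilon> * real (Suc j)) * q (Suc j))) * (kernel_const * majorant js) * ?w"
      by (rule mult_right_mono[OF _ w])
    then show "\<bar>da m (Suc j) u * (z (t - int (Suc j)) * (kernel da js i u * path_weight z (t - int (Suc j)) js))\<bar>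
        \<le> K ^ m * kernel_const * (majorant (j # js) * (z (t - int (Suc j)) * path_weight z (t - int (Suc j)) js))"
      using z_nonneg[OF reg] weight_nonneg[OF reg]
      by (simp add: abs_mult majorant_def mult_ac del: of_nat_Suc)
  qed
qed

lemma
  assumes reg: "regular z" and u: "u \<in> {0..1}" and m: "m \<le> 3" and i: "i \<le> 3"
  shows lagged_series_summable:
      "(\<lambda>j. da m (Suc j) u * (z (t - int (Suc j)) * kernel_series z i u (t - int (Suc j)))) summable_on UNIV"
    and lagged_series_eq:
      "(\<Sum>\<^sub>\<infinity>j. \<Sum>\<^sub>\<infinity>js. da m (Suc j) u * (z (t - int (Suc j)) * (kernel da js i u * path_weight z (t - int (Suc j)) js)))
       = (\<Sum>\<^sub>\<infinity>j. da m (Suc j) u * (z (t - int (Suc j)) * kernel_series z i u (t - int (Suc j))))"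
proof -
  have inner: "(\<Sum>\<^sub>\<infinity>js. da m (Suc j) u * (z (t - int (Suc j)) * (kernel da js i u * path_weight z (t - int (Suc j)) js)))
      = da m (Suc j) u * (z (t - int (Suc j)) * kernel_series z i u (t - int (Suc j)))" for j
    by (simp only: infsum_cmult_right' kernel_series_def)
  show "(\<lambda>j. da m (Suc j) u * (z (t - int (Suc j)) * kernel_series z i u (t - int (Suc j)))) summable_on UNIV"
    using summable_on_Sigma_banach[of
        "\<lambda>j js. da m (Suc j) u * (z (t - int (Suc j)) * (kernel da js i u * path_weight z (t - int (Suc j)) js))"
        UNIV "\<lambda>_. UNIV"] shifted_kernel_summable[OF assms]
    unfolding inner by simp
  show "(\<Sum>\<^sub>\<infinity>j. \<Sum>\<^sub>\<infinity>js. da m (Suc j) u * (z (t - int (Suc j)) * (kernel da js i u * path_weight z (t - int (Suc j)) js)))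
       = (\<Sum>\<^sub>\<infinity>j. da m (Suc j) u * (z (t - int (Suc j)) * kernel_series z i u (t - int (Suc j))))"
    unfolding inner ..
qed

text \<open>Leibniz' rule for \<open>j # js\<close> puts the derivative either on the first coefficient or on the remaining
  kernel; summing over \<open>js\<close> gives the two series of the equation, and the empty list gives \<open>da 1 0 u\<close>.\<close>

lemma kernel_series_1_equation:
  assumes reg: "regular z" and u: "u \<in> {0..1}"
  shows "kernel_series z 1 u t = da 1 0 u
    + (\<Sum>\<^sub>\<infinity>j. da 1 (Suc j) u * (z (t - int (Suc j)) * kernel_series z 0 u (t - int (Suc j))))
    + (\<Sum>\<^sub>\<infinity>j. da 0 (Suc j) u * (z (t - int (Suc j)) * kernel_series z 1 u (t - int (Suc j))))"
proof -
  let ?F = "\<lambda>m i j js. da m (Suc j) u * (z (t - int (Suc j)) * (kernel da js i u * path_weight z (t - int (Suc j)) js))"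
  have row: "?F m i j summable_on UNIV" if "i \<le> 3" for m i j
    by (intro summable_on_cmult_right kernel_weight_summable reg u that)
  have outer: "(\<lambda>j. infsum (?F m i j) UNIV) summable_on UNIV" if "m \<le> 3" "i \<le> 3" for m i
    using summable_on_Sigma_banach[of "?F m i" UNIV "\<lambda>_. UNIV"] shifted_kernel_summable[OF reg u that] by simp
  have "kernel_series z 1 u t = da 1 0 u +
      (\<Sum>\<^sub>\<infinity>j. \<Sum>\<^sub>\<infinity>js. kernel da (j # js) 1 u * path_weight z t (j # js))"
    unfolding kernel_series_def
    by (subst infsum_list_Cons[OF kernel_weight_summable[OF reg u]]) auto
  also have "(\<lambda>j js. kernel da (j # js) 1 u * path_weight z t (j # js)) = (\<lambda>j js. ?F 1 0 j js + ?F 0 1 j js)"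
    by (auto simp: fun_eq_iff algebra_simps)
  also have "(\<Sum>\<^sub>\<infinity>j. \<Sum>\<^sub>\<infinity>js. ?F 1 0 j js + ?F 0 1 j js)
      = (\<Sum>\<^sub>\<infinity>j. infsum (?F 1 0 j) UNIV + infsum (?F 0 1 j) UNIV)"
    by (intro infsum_cong infsum_add row) simp_all
  also have "\<dots> = (\<Sum>\<^sub>\<infinity>j. infsum (?F 1 0 j) UNIV) + (\<Sum>\<^sub>\<infinity>j. infsum (?F 0 1 j) UNIV)"
    by (intro infsum_add outer) simp_all
  finally show ?thesis
    using lagged_series_eq[OF reg u, of 1 0 t] lagged_series_eq[OF reg u, of 0 1 t] by simp
qed

text \<open>The bracketed sums \<open>E t\<close>, in which the factor \<open>z t\<close> of \<open>y t\<close> is left out, satisfy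
  \<open>E t = (\<Sum>j. \<alpha> j * z (t - j - 1) * E (t - j - 1))\<close> and inherit the linear growth of \<open>y\<close> because the first moment of
  the bounds on \<open>\<alpha>\<close> is finite. Iterating \<open>k\<close> times bounds \<open>E T\<close>, up to a constant, by the sum over the lists of length \<open>k\<close>
  in which each path weight is multiplied by the growth reached at the end of the path. These
  sums are blocks of a single convergent series.\<close>

lemma homogeneous_solution_zero:
  assumes reg: "regular z"
    and \<alpha>: "\<And>j. \<bar>\<alpha> j\<bar> \<le> q (Suc j)"
    and eq: "\<And>t. y t = z t * (\<Sum>\<^sub>\<infinity>j. \<alpha> j * y (t - int (Suc j)))"
    and growth: "\<And>n. \<bar>y (T - int n)\<bar> \<le> c * (1 + real n)"
  shows "y T = 0"
proof -
  define E where "E t = (\<Sum>\<^sub>\<infinity>j. \<alpha> j * y (t - int (Suc j)))" for t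
  have yE: "y t = z t * E t" for t unfolding E_def by (rule eq)
  define S where "S = (\<Sum>\<^sub>\<infinity>j. q (Suc j) * (1 + real (Suc j)))"
  have "0 \<le> c" using growth[of 0] by simp
  have lin: "1 + x \<le> (1 + \<epsilon> * x) / \<epsilon>" if "0 \<le> x" for x
    using \<epsilon> that by (simp add: field_simps)
  have q_summ: "(\<lambda>j. q (Suc j) * (1 + real (Suc j))) summable_on UNIV"
  proof (rule summable_on_dominated[OF summable_on_cmult_right[OF tilted_summable, of "1 / \<epsilon>"]])
    fix j
    show "\<bar>q (Suc j) * (1 + real (Suc j))\<bar> \<le> 1 / \<epsilon> * ((1 + \<epsilon> * real (Suc j)) * q (Suc j))"
      using mult_left_mono[OF lin[of "real (Suc j)"], of "q (Suc j)"] q[of "Suc j"]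
      by (simp add: abs_mult mult_ac del: of_nat_Suc)
  qed
  have E_growth: "\<bar>E (T - int n)\<bar> \<le> c * S * (1 + real n)" for n
  proof -
    have "\<bar>E (T - int n)\<bar> \<le> (\<Sum>\<^sub>\<infinity>j. c * (1 + real n) * (q (Suc j) * (1 + real (Suc j))))"
      unfolding E_def
    proof (rule abs_infsum_le[OF summable_on_cmult_right[OF q_summ]])
      fix j
      have "\<bar>y (T - int n - int (Suc j))\<bar> \<le> c * (1 + real (n + Suc j))"
        using growth[of "n + Suc j"] by (simp add: algebra_simps)
      also have "\<dots> \<le> c * ((1 + real n) * (1 + real (Suc j)))"
        using \<open>0 \<le> c\<close> by (intro mult_left_mono) (auto simp: algebra_simps)
      finally have "\<bar>\<alpha> j\<bar> * \<bar>y (T - int n - int (Suc j))\<bar>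
          \<le> q (Suc j) * (c * ((1 + real n) * (1 + real (Suc j))))"
        using \<alpha>[of j] by (intro mult_mono) (auto intro: order_trans[OF abs_ge_zero])
      then show "\<bar>\<alpha> j * y (T - int n - int (Suc j))\<bar>
          \<le> c * (1 + real n) * (q (Suc j) * (1 + real (Suc j)))"
        by (simp add: abs_mult mult_ac)
    qed
    also have "\<dots> = c * S * (1 + real n)"
      unfolding infsum_cmult_right' S_def by (simp only: mult_ac)
    finally show ?thesis .
  qed
  have S0: "0 \<le> S" unfolding S_def by (intro infsum_nonneg) (simp add: q less_imp_le)
  \<comment> \<open>\<open>F n js\<close> is the contribution of the path \<open>js\<close> started at \<open>T - n\<close>; its last factor bounds the growth
    at the endpoint.\<close>
  define F where "F n js = q_prod js * path_weight z (T - int n) js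
    * (1 + real n + real (sum_list (map Suc js)))" for n js
  have F0: "0 \<le> F n js" for n js
    unfolding F_def using q_prod_pos[of js]
    by (intro mult_nonneg_nonneg weight_nonneg[OF reg]) (auto intro!: sum_list_nonneg)
  have F_summ: "F n summable_on UNIV" for n
  proof (rule summable_on_dominated[OF majorant_weight_summable[OF reg, of "(1 + real n) / \<epsilon>" "T - int n"]])
    fix js
    let ?s = "real (sum_list (map Suc js))"
    have "1 + real n + ?s \<le> (1 + real n) * (1 + ?s)" by (simp add: algebra_simps)
    also have "\<dots> \<le> (1 + real n) * ((1 + \<epsilon> * ?s) / \<epsilon>)"
      by (intro mult_left_mono lin) auto
    finally have "(1 + real n + ?s) * q_prod js \<le> ((1 + real n) * ((1 + \<epsilon> * ?s) / \<epsilon>)) * q_prod js"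
      by (rule mult_right_mono) (simp add: q_prod_pos less_imp_le)
    also have "\<dots> = (1 + real n) / \<epsilon> * ((1 + \<epsilon> * ?s) * q_prod js)" by simp
    also have "\<dots> \<le> (1 + real n) / \<epsilon> * majorant js"
      using \<epsilon> by (intro mult_left_mono q_prod_sum_le_majorant) auto
    finally have "(1 + real n + ?s) * q_prod js * path_weight z (T - int n) js
        \<le> (1 + real n) / \<epsilon> * majorant js * path_weight z (T - int n) js"
      by (rule mult_right_mono) (rule weight_nonneg[OF reg])
    then show "\<bar>F n js\<bar> \<le> (1 + real n) / \<epsilon> * (majorant js * path_weight z (T - int n) js)"
      using F0[of n js] by (simp add: F_def mult_ac)
  qed
  have F_Cons: "F n (j # js) = q (Suc j) * z (T - int n - int (Suc j)) * F (n + Suc j) js" for n j js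
  proof -
    have "T - int n - int (Suc j) = T - int (n + Suc j)" by simp
    then show ?thesis by (simp add: F_def q_prod_def algebra_simps)
  qed
  have iter: "\<bar>E (T - int n)\<bar> \<le> c * S * (\<Sum>\<^sub>\<infinity>js | length js = k. F n js)" for n k
  proof (induction k arbitrary: n)
    case 0
    have "{js :: nat list. length js = 0} = {[]}" by auto
    then show ?case using E_growth[of n] by (simp add: F_def q_prod_def)
  next
    case (Suc k)
    let ?L = "{js :: nat list. length js = k}"
    have pairs: "(\<lambda>(j, js). F n (j # js)) summable_on (UNIV \<times> ?L)"
      using summable_on_list_Cons[OF F_summ[of n]] by (rule summable_on_subset) auto
    have "\<bar>E (T - int n)\<bar> \<le> (\<Sum>\<^sub>\<infinity>j. c * S * (\<Sum>\<^sub>\<infinity>js\<in>?L. F n (j # js)))"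
      unfolding E_def[of "T - int n"]
    proof (rule abs_infsum_le[OF summable_on_cmult_right[OF summable_on_Sigma_banach[OF pairs]]])
      fix j
      let ?t = "T - int n - int (Suc j)"
      have t: "?t = T - int (n + Suc j)" by simp
      have "\<bar>\<alpha> j * y ?t\<bar> = \<bar>\<alpha> j\<bar> * (z ?t * \<bar>E ?t\<bar>)"
        by (simp only: yE abs_mult abs_of_nonneg[OF z_nonneg[OF reg]])
      also have "\<dots> \<le> q (Suc j) * (z ?t * (c * S * (\<Sum>\<^sub>\<infinity>js\<in>?L. F (n + Suc j) js)))"
        using Suc.IH[of "n + Suc j"] \<alpha>[of j] q[of "Suc j"] z_nonneg[OF reg, of ?t]
        unfolding t by (intro mult_mono) auto
      also have "\<dots> = c * S * (\<Sum>\<^sub>\<infinity>js\<in>?L. F n (j # js))"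
        unfolding F_Cons infsum_cmult_right' by (simp only: mult_ac)
      finally show "\<bar>\<alpha> j * y ?t\<bar> \<le> c * S * (\<Sum>\<^sub>\<infinity>js\<in>?L. F n (j # js))" .
    qed
    also have "\<dots> = c * S * (\<Sum>\<^sub>\<infinity>js | length js = Suc k. F n js)"
      by (simp only: infsum_cmult_right' infsum_length_Suc[OF F_summ])
    finally show ?case .
  qed
  have "(\<lambda>k. \<Sum>\<^sub>\<infinity>js | length js = k. F 0 js) \<longlonglongrightarrow> 0"
    by (intro summable_LIMSEQ_zero summable_on_imp_summable summable_on_infsum_length F_summ)
  then have "(\<lambda>k. c * S * (\<Sum>\<^sub>\<infinity>js | length js = k. F 0 js)) \<longlonglongrightarrow> c * S * 0"
    by (rule tendsto_mult_left)
  then have "\<bar>E T\<bar> \<le> c * S * 0"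
    by (rule LIMSEQ_le_const) (use iter[of 0] in auto)
  then show ?thesis by (simp add: yE)
qed

end

section \<open>Independent innovations\<close>

text \<open>By stationarity the probabilities of \<open>\<bar>Y (t - n)\<bar> > n\<close> are tail probabilities of one integrable
  variable, hence summable over \<open>n\<close>, and the Borel-Cantelli lemma applies.\<close>

lemma (in prob_space) stationary_integrable_growth:
  assumes stat: "stationary_process M Y" and int: "\<And>t. integrable M (Y t)"
  shows "AE \<omega> in M. \<forall>t. \<exists>c. \<forall>n. \<bar>Y (t - int n) \<omega>\<bar> \<le> c * (1 + real n)"
proof (subst AE_all_countable, intro allI)
  fix t
  have Y[measurable]: "Y s \<in> borel_measurable M" for s
    using stat by (simp add: stationary_process_def)
  let ?P = "\<Pi>\<^sub>M t\<in>(UNIV::int set). (borel :: real measure)"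
  have path: "(\<lambda>\<omega> s. Y (s + h) \<omega>) \<in> measurable M ?P" for h
    by (rule measurable_PiM_single') auto
  let ?A = "\<lambda>n. {\<omega> \<in> space M. real n < \<bar>Y (t - int n) \<omega>\<bar>}"
  have shift: "prob (?A n) = prob {\<omega> \<in> space M. real n < \<bar>Y t \<omega>\<bar>}" for n
  proof -
    let ?B = "{x \<in> space ?P. real n < \<bar>x t\<bar>}"
    have B: "?B \<in> sets ?P" by measurable
    have vim: "(\<lambda>\<omega> s. Y (s + h) \<omega>) -` ?B \<inter> space M = {\<omega> \<in> space M. real n < \<bar>Y (t + h) \<omega>\<bar>}" for h
      by (auto simp: space_PiM)
    have "measure (distr M ?P (\<lambda>\<omega> s. Y (s + (- int n)) \<omega>)) ?B = measure (distr M ?P (\<lambda>\<omega> s. Y s \<omega>)) ?B"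
      using stat unfolding stationary_process_def by metis
    then show ?thesis
      using measure_distr[OF path B, of "- int n"] measure_distr[OF path B, of 0] vim[of "- int n"] vim[of 0]
      by simp
  qed
  have count: "(\<Sum>n<N. indicator {x. real n < x} y) \<le> 1 + y" if "0 \<le> y" for N and y :: real
  proof (induction N)
    case (Suc N)
    have "(\<Sum>n<N. indicator {x. real n < x} y) \<le> (\<Sum>n<N. 1 :: real)"
      by (intro sum_mono) (auto simp: indicator_def)
    then show ?case using Suc that by (auto simp: indicator_def)
  qed (use that in simp)
  have "summable (\<lambda>n. prob (?A n))"
  proof (rule summableI_nonneg_bounded)
    fix N
    have "(\<Sum>n<N. prob (?A n)) = (\<Sum>n<N. \<integral>\<omega>. indicator {x. real n < x} \<bar>Y t \<omega>\<bar> \<partial>M)"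
      unfolding shift
    proof (rule sum.cong[OF refl])
      fix n
      have "(\<integral>\<omega>. indicator {x. real n < x} \<bar>Y t \<omega>\<bar> \<partial>M)
          = (\<integral>\<omega>. indicat_real {\<omega> \<in> space M. real n < \<bar>Y t \<omega>\<bar>} \<omega> \<partial>M)"
        by (intro Bochner_Integration.integral_cong) (auto simp: indicator_def)
      then show "prob {\<omega> \<in> space M. real n < \<bar>Y t \<omega>\<bar>} = (\<integral>\<omega>. indicator {x. real n < x} \<bar>Y t \<omega>\<bar> \<partial>M)"
        by simp
    qed
    also have "\<dots> = (\<integral>\<omega>. (\<Sum>n<N. indicator {x. real n < x} \<bar>Y t \<omega>\<bar>) \<partial>M)"
      by (rule Bochner_Integration.integral_sum[symmetric])
        (rule integrable_const_bound[where B = 1], auto simp: indicator_def)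
    also have "\<dots> \<le> (\<integral>\<omega>. 1 + \<bar>Y t \<omega>\<bar> \<partial>M)"
      using count int[of t]
      by (intro integral_mono Bochner_Integration.integrable_sum)
        (auto intro!: integrable_const_bound[where B = 1] simp: indicator_def)
    finally show "(\<Sum>n<N. prob (?A n)) \<le> (\<integral>\<omega>. 1 + \<bar>Y t \<omega>\<bar> \<partial>M)" .
  qed auto
  then have "AE \<omega> in M. eventually (\<lambda>n. \<omega> \<in> space M - ?A n) sequentially"
    by (intro borel_cantelli_AE1) (auto simp: emeasure_eq_measure)
  then show "AE \<omega> in M. \<exists>c. \<forall>n. \<bar>Y (t - int n) \<omega>\<bar> \<le> c * (1 + real n)"
  proof eventually_elim
    case (elim \<omega>)
    then obtain N where N: "\<And>n. N \<le> n \<Longrightarrow> \<bar>Y (t - int n) \<omega>\<bar> \<le> real n"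
      by (auto simp: eventually_sequentially not_less)
    define c where "c = 1 + (\<Sum>n<N. \<bar>Y (t - int n) \<omega>\<bar>)"
    have c1: "1 \<le> c" by (simp add: c_def sum_nonneg)
    have "\<bar>Y (t - int n) \<omega>\<bar> \<le> c * (1 + real n)" for n
    proof (cases "n < N")
      case True
      then have "\<bar>Y (t - int n) \<omega>\<bar> \<le> (\<Sum>n<N. \<bar>Y (t - int n) \<omega>\<bar>)"
        by (intro member_le_sum) auto
      also have "\<dots> \<le> c * 1" by (simp add: c_def)
      also have "\<dots> \<le> c * (1 + real n)" using c1 by (intro mult_left_mono) auto
      finally show ?thesis .
    next
      case False
      then have "\<bar>Y (t - int n) \<omega>\<bar> \<le> 1 * (1 + real n)" using N[of n] by auto
      also have "\<dots> \<le> c * (1 + real n)" using c1 by (intro mult_right_mono) auto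
      finally show ?thesis .
    qed
    then show ?case by blast
  qed
qed

text \<open>The law of the path is a power of a single distribution, and a product measure with equal
  factors is invariant under reindexing.\<close>

lemma (in prob_space) iid_shift_law:
  fixes Z :: "int \<Rightarrow> 'a \<Rightarrow> real"
  assumes indep: "indep_vars (\<lambda>_. borel) Z UNIV"
    and ident: "\<And>s t. distr M borel (Z s) = distr M borel (Z t)"
  shows "distr M (\<Pi>\<^sub>M s\<in>UNIV. borel) (\<lambda>\<omega> s. Z (s + h) \<omega>) = distr M (\<Pi>\<^sub>M s\<in>UNIV. borel) (\<lambda>\<omega> s. Z s \<omega>)"
proof -
  have Z[measurable]: "Z s \<in> borel_measurable M" for s
    using indep by (simp add: indep_vars_def)
  let ?P = "\<Pi>\<^sub>M s\<in>(UNIV::int set). (borel :: real measure)"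
  define N where "N = distr M borel (Z 0)"
  have N: "prob_space N" "sets N = sets borel" unfolding N_def by (auto intro: prob_space_distr)
  have N': "(\<lambda>s. distr M borel (Z s)) = (\<lambda>s. N)" unfolding N_def using ident by blast
  have law: "distr M ?P (\<lambda>\<omega> s. Z s \<omega>) = (\<Pi>\<^sub>M s\<in>(UNIV::int set). N)"
    using indep_vars_iff_distr_eq_PiM[where I = UNIV and M' = "\<lambda>_. borel" and X = Z] indep N'
    by (simp add: restrict_UNIV)
  have path: "(\<lambda>\<omega> s. Z s \<omega>) \<in> measurable M ?P"
    by (rule measurable_PiM_single') auto
  have shift: "(\<lambda>x s. x (s + h)) \<in> measurable ?P ?P"
    by (rule measurable_PiM_single') auto
  have "distr M ?P (\<lambda>\<omega> s. Z (s + h) \<omega>) = distr (distr M ?P (\<lambda>\<omega> s. Z s \<omega>)) ?P (\<lambda>x s. x (s + h))"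
    by (subst distr_distr[OF shift path]) (simp add: comp_def)
  also have "\<dots> = distr (\<Pi>\<^sub>M s\<in>(UNIV::int set). N) (\<Pi>\<^sub>M s\<in>(UNIV::int set). N) (\<lambda>x s. x (s + h))"
    unfolding law by (intro distr_cong refl sets_PiM_cong) (auto simp: N(2))
  also have "\<dots> = (\<Pi>\<^sub>M s\<in>(UNIV::int set). N)"
    using distr_PiM_reindex[of UNIV "\<lambda>_. N" "\<lambda>s. s + h" UNIV] N(1) by (simp add: restrict_UNIV)
  finally show ?thesis by (simp add: law)
qed

lemma stationary_process_shift_equivariant:
  fixes Z :: "int \<Rightarrow> 'w \<Rightarrow> real" and \<Psi> :: "(int \<Rightarrow> real) \<Rightarrow> int \<Rightarrow> real"
  assumes Z: "\<And>s. Z s \<in> borel_measurable M"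
    and law: "\<And>h. distr M (\<Pi>\<^sub>M s\<in>UNIV. borel) (\<lambda>\<omega> s. Z (s + h) \<omega>)
                  = distr M (\<Pi>\<^sub>M s\<in>UNIV. borel) (\<lambda>\<omega> s. Z s \<omega>)"
    and \<Psi>: "\<And>t. (\<lambda>x. \<Psi> x t) \<in> borel_measurable (\<Pi>\<^sub>M s\<in>UNIV. borel)"
    and equiv: "\<And>x t h. \<Psi> (\<lambda>s. x (s + h)) t = \<Psi> x (t + h)"
  shows "stationary_process M (\<lambda>t \<omega>. \<Psi> (\<lambda>s. Z s \<omega>) t)"
proof -
  let ?P = "\<Pi>\<^sub>M s\<in>(UNIV::int set). (borel :: real measure)"
  have path: "(\<lambda>\<omega> s. Z (s + h) \<omega>) \<in> measurable M ?P" for h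
    using Z by (intro measurable_PiM_single') auto
  have path0: "(\<lambda>\<omega> s. Z s \<omega>) \<in> measurable M ?P" using path[of 0] by simp
  have \<Psi>P: "\<Psi> \<in> measurable ?P ?P"
    by (rule measurable_PiM_single'[where f = "\<lambda>t x. \<Psi> x t"]) (use \<Psi> in auto)
  have "distr M ?P (\<lambda>\<omega> t. \<Psi> (\<lambda>s. Z s \<omega>) (t + h)) = distr M ?P (\<lambda>\<omega> t. \<Psi> (\<lambda>s. Z s \<omega>) t)" for h
  proof -
    have "distr M ?P (\<lambda>\<omega> t. \<Psi> (\<lambda>s. Z s \<omega>) (t + h)) = distr (distr M ?P (\<lambda>\<omega> s. Z (s + h) \<omega>)) ?P \<Psi>"
      by (subst distr_distr[OF \<Psi>P path]) (simp add: comp_def equiv[symmetric])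
    also have "\<dots> = distr M ?P (\<lambda>\<omega> t. \<Psi> (\<lambda>s. Z s \<omega>) t)"
      unfolding law by (subst distr_distr[OF \<Psi>P path0]) (simp add: comp_def)
    finally show ?thesis .
  qed
  moreover have "(\<lambda>\<omega>. \<Psi> (\<lambda>s. Z s \<omega>) t) \<in> borel_measurable M" for t
    by (rule measurable_compose[OF path0 \<Psi>])
  ultimately show ?thesis by (simp add: stationary_process_def)
qed

text \<open>The times whose squared innovations make up a path weight. They strictly decrease along the list, so none is
  visited twice; independence then gives every path weight the mean one.\<close>

primrec visited :: "int \<Rightarrow> nat list \<Rightarrow> int set" where
  "visited t [] = {}"
| "visited t (j # js) = insert (t - int (Suc j)) (visited (t - int (Suc j)) js)"

lemma visited_less: "s \<in> visited t js \<Longrightarrow> s < t"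
  by (induction js arbitrary: t) force+

lemma finite_visited: "finite (visited t js)"
  by (induction js arbitrary: t) auto

lemma path_weight_eq_prod: "path_weight z t js = (\<Prod>s\<in>visited t js. z s)"
proof (induction js arbitrary: t)
  case (Cons j js)
  have "t - int (Suc j) \<notin> visited (t - int (Suc j)) js" using visited_less by blast
  from prod.insert[OF finite_visited this, of z] show ?case
    by (simp only: path_weight.simps visited.simps Cons)
qed simp

lemma borel_measurable_path_weight:
  assumes "\<And>s. z s \<in> borel_measurable M"
  shows "(\<lambda>\<omega>. path_weight (\<lambda>s. z s \<omega>) t js) \<in> borel_measurable M"
  unfolding path_weight_eq_prod using assms by measurable

lemma (in prob_space) nn_integral_path_weight:
  assumes indep: "indep_vars (\<lambda>_. borel) Z UNIV"
    and unit: "\<And>t. (\<integral>\<omega>. (Z t \<omega>)\<^sup>2 \<partial>M) = 1"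
  shows "(\<integral>\<^sup>+\<omega>. ennreal (path_weight (\<lambda>s. (Z s \<omega>)\<^sup>2) t js) \<partial>M) = 1"
proof -
  have "integrable M (\<lambda>\<omega>. (Z s \<omega>)\<^sup>2)" for s
    using unit[of s] not_integrable_integral_eq by fastforce
  then have sq: "(\<integral>\<^sup>+\<omega>. ennreal ((Z s \<omega>)\<^sup>2) \<partial>M) = 1" for s
    using unit[of s] by (subst nn_integral_eq_integral) auto
  have "indep_vars (\<lambda>_. borel) (\<lambda>s \<omega>. ennreal ((Z s \<omega>)\<^sup>2)) (visited t js)"
    by (rule indep_vars_compose2[OF indep_vars_subset[OF indep]]) auto
  then have "(\<integral>\<^sup>+\<omega>. (\<Prod>s\<in>visited t js. ennreal ((Z s \<omega>)\<^sup>2)) \<partial>M)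
      = (\<Prod>s\<in>visited t js. \<integral>\<^sup>+\<omega>. ennreal ((Z s \<omega>)\<^sup>2) \<partial>M)"
    by (intro indep_vars_nn_integral finite_visited) auto
  then show ?thesis
    by (simp add: path_weight_eq_prod prod_ennreal sq)
qed

locale arch_innovations = prob_space M + smooth_coefficients da q K \<epsilon>
  for M :: "'w measure" and da q K \<epsilon> +
  fixes Z :: "int \<Rightarrow> 'w \<Rightarrow> real"
  assumes indep: "indep_vars (\<lambda>_. borel) Z UNIV"
    and ident: "\<And>s t. distr M borel (Z s) = distr M borel (Z t)"
    and unit: "\<And>t. (\<integral>\<omega>. (Z t \<omega>)\<^sup>2 \<partial>M) = 1"
begin

lemma Z_measurable [measurable]: "Z s \<in> borel_measurable M"
  using indep by (simp add: indep_vars_def)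

text \<open>The expectation of the series is the sum of the majorants, which is finite; countably many times
  share one null set.\<close>

lemma AE_regular:
  shows "AE \<omega> in M. regular (\<lambda>s. (Z s \<omega>)\<^sup>2)"
proof -
  let ?U = "\<lambda>t js \<omega>. path_weight (\<lambda>s. (Z s \<omega>)\<^sup>2) t js"
  have [measurable]: "?U t js \<in> borel_measurable M" for t js
    by (rule borel_measurable_path_weight) auto
  have "AE \<omega> in M. (\<lambda>js. majorant js * ?U t js \<omega>) summable_on UNIV" for t
  proof -
    let ?f = "\<lambda>n \<omega>. majorant (list_decode n) * ?U t (list_decode n) \<omega>"
    have "(\<integral>\<^sup>+\<omega>. (\<Sum>n. ennreal (?f n \<omega>)) \<partial>M) = (\<Sum>n. \<integral>\<^sup>+\<omega>. ennreal (?f n \<omega>) \<partial>M)"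
      by (rule nn_integral_suminf) auto
    also have "\<dots> = (\<Sum>n. ennreal (majorant (list_decode n)))"
      using nn_integral_path_weight[OF indep unit] majorant_pos
      by (simp add: ennreal_mult' less_imp_le nn_integral_cmult)
    also have "\<dots> = ennreal (\<Sum>n. majorant (list_decode n))"
      using summable_on_list_iff_summable[of majorant] majorant_summable majorant_pos
      by (intro suminf_ennreal2) (auto simp: less_imp_le)
    finally have "(\<integral>\<^sup>+\<omega>. (\<Sum>n. ennreal (?f n \<omega>)) \<partial>M) \<noteq> \<infinity>" by simp
    then have "AE \<omega> in M. (\<Sum>n. ennreal (?f n \<omega>)) \<noteq> \<infinity>"
      by (intro nn_integral_noteq_infinite) auto
    then show ?thesis
    proof eventually_elim
      case (elim \<omega>)
      have nonneg: "0 \<le> majorant js * ?U t js \<omega>" for js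
        by (intro mult_nonneg_nonneg path_weight_nonneg) (auto simp: majorant_pos less_imp_le)
      with elim have "summable (\<lambda>n. ?f n \<omega>)" by (intro summable_suminf_not_top) auto
      then show ?case by (subst summable_on_list_iff_summable) (use nonneg in auto)
    qed
  qed
  then have "AE \<omega> in M. \<forall>t. (\<lambda>js. majorant js * ?U t js \<omega>) summable_on UNIV"
    by (simp add: AE_all_countable)
  then show ?thesis by eventually_elim (simp add: regular_def)
qed

text \<open>A version of the \<open>i\<close>-th derivative that is defined for every innovation sequence \<open>x\<close>. Summing along the
  enumeration of lists makes it measurable at once, as a limit of partial sums; on regular
  sequences the order of summation is immaterial.\<close>

definition kernel_functional :: "nat \<Rightarrow> real \<Rightarrow> (int \<Rightarrow> real) \<Rightarrow> int \<Rightarrow> real" where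
  "kernel_functional i u x t =
     (\<Sum>n. kernel da (list_decode n) i u * ((x t)\<^sup>2 * path_weight (\<lambda>s. (x s)\<^sup>2) t (list_decode n)))"

lemma kernel_functional_eq:
  assumes reg: "regular (\<lambda>s. (x s)\<^sup>2)" and "u \<in> {0..1}" "i \<le> 3"
  shows "kernel_functional i u x t = (x t)\<^sup>2 * kernel_series (\<lambda>s. (x s)\<^sup>2) i u t"
proof -
  let ?f = "\<lambda>js. kernel da js i u * ((x t)\<^sup>2 * path_weight (\<lambda>s. (x s)\<^sup>2) t js)"
  have f: "?f = (\<lambda>js. (x t)\<^sup>2 * (kernel da js i u * path_weight (\<lambda>s. (x s)\<^sup>2) t js))"
    by (auto simp: mult_ac)
  have "?f summable_on UNIV"
    unfolding f by (intro summable_on_cmult_right kernel_weight_summable assms)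
  then have "(?f has_sum infsum ?f UNIV) UNIV" by simp
  then have "((\<lambda>n. ?f (list_decode n)) has_sum infsum ?f UNIV) UNIV"
    by (subst has_sum_reindex_bij_betw[OF bij_list_decode])
  then have "kernel_functional i u x t = infsum ?f UNIV"
    unfolding kernel_functional_def by (intro sums_unique[symmetric] has_sum_imp_sums)
  also have "\<dots> = (x t)\<^sup>2 * kernel_series (\<lambda>s. (x s)\<^sup>2) i u t"
    unfolding f kernel_series_def by (rule infsum_cmult_right')
  finally show ?thesis .
qed

lemma kernel_functional_stationary:
  shows "stationary_process M (\<lambda>t \<omega>. kernel_functional i u (\<lambda>s. Z s \<omega>) t)"
proof (rule stationary_process_shift_equivariant[where Z = Z and \<Psi> = "kernel_functional i u"])
  show "Z s \<in> borel_measurable M" for s by measurable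
  show "distr M (\<Pi>\<^sub>M s\<in>UNIV. borel) (\<lambda>\<omega> s. Z (s + h) \<omega>) = distr M (\<Pi>\<^sub>M s\<in>UNIV. borel) (\<lambda>\<omega> s. Z s \<omega>)" for h
    by (rule iid_shift_law[OF indep ident])
  show "(\<lambda>x. kernel_functional i u x t) \<in> borel_measurable (\<Pi>\<^sub>M s\<in>UNIV. borel)" for t
    unfolding kernel_functional_def
    by (intro borel_measurable_suminf borel_measurable_times borel_measurable_path_weight) measurable
  show "kernel_functional i u (\<lambda>s. x (s + h)) t = kernel_functional i u x (t + h)" for x t h
    using path_weight_shift[of "\<lambda>s. (x s)\<^sup>2" h] by (simp add: kernel_functional_def)
qed

lemma kernel_functional_integrable:
  assumes u: "u \<in> {0..1}" and i: "i \<le> 3"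
  shows "integrable M (\<lambda>\<omega>. kernel_functional i u (\<lambda>s. Z s \<omega>) t)"
proof -
  let ?W = "\<lambda>js \<omega>. (Z t \<omega>)\<^sup>2 * path_weight (\<lambda>s. (Z s \<omega>)\<^sup>2) t js"
  \<comment> \<open>The weight including the factor at time \<open>t\<close> is itself a path weight, for the path that starts one
    step later with lag one.\<close>
  have W: "?W js \<omega> = path_weight (\<lambda>s. (Z s \<omega>)\<^sup>2) (t + 1) (0 # js)" for js \<omega> by simp
  have [measurable]: "?W js \<in> borel_measurable M" for js
    unfolding W by (rule borel_measurable_path_weight) auto
  have W0: "0 \<le> ?W js \<omega>" for js \<omega> by (intro mult_nonneg_nonneg path_weight_nonneg) auto
  have nn: "(\<integral>\<^sup>+\<omega>. ennreal (?W js \<omega>) \<partial>M) = ennreal 1" for js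
    unfolding W using nn_integral_path_weight[OF indep unit, of "t + 1" "0 # js"]
    by (simp del: path_weight.simps)
  have Wint: "integrable M (?W js)" and W1: "(\<integral>\<omega>. ?W js \<omega> \<partial>M) = 1" for js
  proof -
    show "integrable M (?W js)"
      by (rule integrableI_nn_integral_finite[OF _ _ nn]) (use W0 in auto)
    show "(\<integral>\<omega>. ?W js \<omega> \<partial>M) = 1"
      using nn by (subst integral_eq_nn_integral) (use W0 in auto)
  qed
  show ?thesis
    unfolding kernel_functional_def
  proof (rule integrable_suminf)
    show "integrable M (\<lambda>\<omega>. kernel da (list_decode n) i u * ?W (list_decode n) \<omega>)" for n
      using Wint by simp
    show "AE \<omega> in M. summable (\<lambda>n. norm (kernel da (list_decode n) i u * ?W (list_decode n) \<omega>))"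
      using AE_regular
    proof eventually_elim
      case (elim \<omega>)
      have "(\<lambda>js. (Z t \<omega>)\<^sup>2 * (kernel da js i u * path_weight (\<lambda>s. (Z s \<omega>)\<^sup>2) t js)) summable_on UNIV"
        by (intro summable_on_cmult_right kernel_weight_summable elim u i)
      then have "(\<lambda>js. \<bar>kernel da js i u * ?W js \<omega>\<bar>) summable_on UNIV"
        using summable_on_iff_abs_summable_on_real by (force simp: mult_ac)
      then show ?case by (subst (asm) summable_on_list_iff_summable) auto
    qed
    have "(\<lambda>js. kernel_const * majorant js) summable_on UNIV"
      by (intro summable_on_cmult_right majorant_summable)
    then have "(\<lambda>js. \<bar>kernel da js i u\<bar>) summable_on UNIV"
      by (rule summable_on_dominated) (use kernel_le_majorant[OF u i] in auto)
    then have "summable (\<lambda>n. \<bar>kernel da (list_decode n) i u\<bar>)"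
      by (subst (asm) summable_on_list_iff_summable) auto
    moreover have "(\<integral>\<omega>. norm (kernel da js i u * ?W js \<omega>) \<partial>M) = \<bar>kernel da js i u\<bar>" for js
    proof -
      have "norm (kernel da js i u * ?W js \<omega>) = \<bar>kernel da js i u\<bar> * ?W js \<omega>" for \<omega>
        using W0[of \<omega> js] by (simp only: real_norm_def abs_mult[of "kernel da js i u"] abs_of_nonneg)
      then show ?thesis using W1[of js] by simp
    qed
    ultimately show "summable (\<lambda>n. \<integral>\<omega>. norm (kernel da (list_decode n) i u * ?W (list_decode n) \<omega>) \<partial>M)"
      by simp
  qed
qed

end

section \<open>The derivative processes\<close>

context arch_innovations
begin

lemma AE_square_eq_kernel_series:
  assumes "stationary_arch M Z (da 0) X"
  shows "AE \<omega> in M. regular (\<lambda>s. (Z s \<omega>)\<^sup>2) \<and>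
    (\<forall>v\<in>{0..1}. \<forall>t. (X v t \<omega>)\<^sup>2 = (Z t \<omega>)\<^sup>2 * kernel_series (\<lambda>s. (Z s \<omega>)\<^sup>2) 0 v t)"
proof -
  have "AE \<omega> in M. \<forall>u\<in>{0..1}. \<forall>t. (X u t \<omega>)\<^sup>2 = volterra_series Z (da 0) u t \<omega>"
    using assms by (simp add: stationary_arch_def)
  then show ?thesis using AE_regular
  proof eventually_elim
    case (elim \<omega>)
    have "volterra_series Z (da 0) v t \<omega> = (Z t \<omega>)\<^sup>2 * kernel_series (\<lambda>s. (Z s \<omega>)\<^sup>2) 0 v t"
      if "v \<in> {0..1}" for v t
      unfolding kernel_series_def
      by (intro volterra_series_eq_kernel_series kernel_weight_summable elim that) simp
    then show ?case using elim by simp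
  qed
qed

lemma sq_deriv_process_kernel_functional:
  assumes X: "stationary_arch M Z (da 0) X" and u: "u \<in> {0<..<1}" and i: "i \<le> 3"
  shows "sq_deriv_process M X i u (\<lambda>t \<omega>. kernel_functional i u (\<lambda>s. Z s \<omega>) t)"
  unfolding sq_deriv_process_def using AE_square_eq_kernel_series[OF X]
proof eventually_elim
  case (elim \<omega>)
  let ?z = "\<lambda>s. (Z s \<omega>)\<^sup>2"
  have "(deriv ^^ i) (\<lambda>v. (X v t \<omega>)\<^sup>2) u = ?z t * kernel_series ?z i u t" for t
    by (rule iterated_deriv_eq_kernel_series(1)) (use elim i u in auto)
  moreover have "kernel_functional i u (\<lambda>s. Z s \<omega>) t = ?z t * kernel_series ?z i u t" for t
    by (rule kernel_functional_eq) (use elim i u in auto)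
  ultimately show ?case by simp
qed

lemma AE_square_differentiable:
  assumes X: "stationary_arch M Z (da 0) X"
  shows "AE \<omega> in M. \<forall>t. \<forall>u\<in>{0<..<1}. \<forall>i<3. (deriv ^^ i) (\<lambda>v. (X v t \<omega>)\<^sup>2) field_differentiable at u"
  using AE_square_eq_kernel_series[OF X]
proof eventually_elim
  case (elim \<omega>)
  have "((deriv ^^ i) (\<lambda>v. (X v t \<omega>)\<^sup>2) has_real_derivative
      (Z t \<omega>)\<^sup>2 * kernel_series (\<lambda>s. (Z s \<omega>)\<^sup>2) (Suc i) u t) (at u)"
    if "u \<in> {0<..<1}" "i < 3" for t u i
    by (rule iterated_deriv_eq_kernel_series(2)) (use elim that in auto)
  then show ?case unfolding field_differentiable_def by blast
qed

text \<open>The equation of the kernel series in terms of processes: multiplication by the squared innovation turns the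
  series of order 0 and 1 into the squared process and its derivative.\<close>

lemma derivative_equation_kernel_functional:
  assumes X: "stationary_arch M Z (da 0) X" and u: "u \<in> {0..1}"
  shows "derivative_equation M Z (da 0) (da 1) X u (\<lambda>t \<omega>. kernel_functional 1 u (\<lambda>s. Z s \<omega>) t)"
  unfolding derivative_equation_def using AE_square_eq_kernel_series[OF X]
proof eventually_elim
  case (elim \<omega>)
  let ?z = "\<lambda>s. (Z s \<omega>)\<^sup>2"
  have reg: "regular ?z" using elim by blast
  have X_eq: "(X u t \<omega>)\<^sup>2 = ?z t * kernel_series ?z 0 u t" for t using elim u by blast
  have D_eq: "kernel_functional i u (\<lambda>s. Z s \<omega>) t = ?z t * kernel_series ?z i u t" if "i \<le> 3" for i t
    by (rule kernel_functional_eq[OF reg u that])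
  show ?case
  proof (intro allI conjI)
    fix t
    show "(\<lambda>j. da 1 j u * (X u (t - int j) \<omega>)\<^sup>2) summable_on {1..}"
      using lagged_series_summable[OF reg u, of 1 0 t]
      by (subst summable_on_from_1[symmetric]) (simp add: X_eq)
    show "(\<lambda>j. da 0 j u * kernel_functional 1 u (\<lambda>s. Z s \<omega>) (t - int j)) summable_on {1..}"
      using lagged_series_summable[OF reg u, of 0 1 t]
      by (subst summable_on_from_1[symmetric]) (simp add: D_eq)
    have "(\<Sum>\<^sub>\<infinity>j\<in>{1..}. da 1 j u * (X u (t - int j) \<omega>)\<^sup>2)
        = (\<Sum>\<^sub>\<infinity>j. da 1 (Suc j) u * (?z (t - int (Suc j)) * kernel_series ?z 0 u (t - int (Suc j))))"
      by (subst infsum_from_1[symmetric]) (simp add: X_eq)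
    moreover have "(\<Sum>\<^sub>\<infinity>j\<in>{1..}. da 0 j u * kernel_functional 1 u (\<lambda>s. Z s \<omega>) (t - int j))
        = (\<Sum>\<^sub>\<infinity>j. da 0 (Suc j) u * (?z (t - int (Suc j)) * kernel_series ?z 1 u (t - int (Suc j))))"
      by (subst infsum_from_1[symmetric]) (simp add: D_eq)
    ultimately show "kernel_functional 1 u (\<lambda>s. Z s \<omega>) t =
        (da 1 0 u + (\<Sum>\<^sub>\<infinity>j\<in>{1..}. da 1 j u * (X u (t - int j) \<omega>)\<^sup>2)
          + (\<Sum>\<^sub>\<infinity>j\<in>{1..}. da 0 j u * kernel_functional 1 u (\<lambda>s. Z s \<omega>) (t - int j))) * (Z t \<omega>)\<^sup>2"
      using kernel_series_1_equation[OF reg u, of t] by (simp add: D_eq)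
  qed
qed

lemma derivative_equation_unique:
  assumes u: "u \<in> {0..1}"
    and Y: "derivative_equation M Z (da 0) (da 1) X u Y"
      "stationary_process M Y" "\<And>t. integrable M (Y t)"
    and Y': "derivative_equation M Z (da 0) (da 1) X u Y'"
      "stationary_process M Y'" "\<And>t. integrable M (Y' t)"
  shows "AE \<omega> in M. \<forall>t. Y t \<omega> = Y' t \<omega>"
  using AE_regular Y(1)[unfolded derivative_equation_def] Y'(1)[unfolded derivative_equation_def]
    stationary_integrable_growth[OF Y(2,3)] stationary_integrable_growth[OF Y'(2,3)]
proof eventually_elim
  case (elim \<omega>)
  let ?z = "\<lambda>s. (Z s \<omega>)\<^sup>2"
  define y where "y t = Y t \<omega> - Y' t \<omega>" for t
  have homogeneous: "y t = ?z t * (\<Sum>\<^sub>\<infinity>j. da 0 (Suc j) u * y (t - int (Suc j)))" for t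
  proof -
    have s: "(\<lambda>j. da 0 j u * Y (t - int j) \<omega>) summable_on {1..}"
        "(\<lambda>j. da 0 j u * Y' (t - int j) \<omega>) summable_on {1..}"
      using elim by blast+
    have "(\<Sum>\<^sub>\<infinity>j. da 0 (Suc j) u * y (t - int (Suc j))) = (\<Sum>\<^sub>\<infinity>j\<in>{1..}. da 0 j u * y (t - int j))"
      by (rule infsum_from_1)
    also have "\<dots> = (\<Sum>\<^sub>\<infinity>j\<in>{1..}. da 0 j u * Y (t - int j) \<omega> + - (da 0 j u * Y' (t - int j) \<omega>))"
      by (simp add: y_def algebra_simps)
    also have "\<dots> = (\<Sum>\<^sub>\<infinity>j\<in>{1..}. da 0 j u * Y (t - int j) \<omega>)
        - (\<Sum>\<^sub>\<infinity>j\<in>{1..}. da 0 j u * Y' (t - int j) \<omega>)"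
      using s by (subst infsum_add) (auto simp: infsum_uminus summable_on_uminus)
    finally have *: "(\<Sum>\<^sub>\<infinity>j. da 0 (Suc j) u * y (t - int (Suc j))) = \<dots>" .
    have cancel: "p - p' = (r - r') * w" if "p = (k + r) * w" "p' = (k + r') * w" for p p' k r r' w :: real
      using that by (simp add: algebra_simps)
    have "Y t \<omega> = (da 1 0 u + (\<Sum>\<^sub>\<infinity>j\<in>{1..}. da 1 j u * (X u (t - int j) \<omega>)\<^sup>2)
          + (\<Sum>\<^sub>\<infinity>j\<in>{1..}. da 0 j u * Y (t - int j) \<omega>)) * (Z t \<omega>)\<^sup>2"
      "Y' t \<omega> = (da 1 0 u + (\<Sum>\<^sub>\<infinity>j\<in>{1..}. da 1 j u * (X u (t - int j) \<omega>)\<^sup>2)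
          + (\<Sum>\<^sub>\<infinity>j\<in>{1..}. da 0 j u * Y' (t - int j) \<omega>)) * (Z t \<omega>)\<^sup>2"
      using elim by blast+
    then have "y t = ((\<Sum>\<^sub>\<infinity>j\<in>{1..}. da 0 j u * Y (t - int j) \<omega>)
        - (\<Sum>\<^sub>\<infinity>j\<in>{1..}. da 0 j u * Y' (t - int j) \<omega>)) * (Z t \<omega>)\<^sup>2"
      unfolding y_def by (rule cancel)
    then show ?thesis unfolding * by (simp only: mult.commute)
  qed
  have "y t = 0" for t
  proof -
    obtain c c' where c: "\<And>n. \<bar>Y (t - int n) \<omega>\<bar> \<le> c * (1 + real n)"
      and c': "\<And>n. \<bar>Y' (t - int n) \<omega>\<bar> \<le> c' * (1 + real n)"
      using elim by metis
    have "\<bar>y (t - int n)\<bar> \<le> (c + c') * (1 + real n)" for n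
      using c[of n] c'[of n] unfolding y_def distrib_right by linarith
    then show ?thesis
      by (intro homogeneous_solution_zero[where z = ?z and \<alpha> = "\<lambda>j. da 0 (Suc j) u" and c = "c + c'"]
            homogeneous elim) (use coeff_bound[OF _ u, of 0] in auto)
  qed
  then show ?case by (simp add: y_def)
qed

end

theorem theorem4:
  fixes M :: "'w measure"
    and Z :: "int \<Rightarrow> 'w \<Rightarrow> real"
    and a :: "nat \<Rightarrow> real \<Rightarrow> real"
    and da :: "nat \<Rightarrow> nat \<Rightarrow> real \<Rightarrow> real"
    and l :: "nat \<Rightarrow> real"
    and \<rho> Q B \<nu> C :: real
    and X :: "real \<Rightarrow> int \<Rightarrow> 'w \<Rightarrow> real"
  assumes "prob_space M"
    and "prob_space.indep_vars M (\<lambda>_. borel) Z UNIV"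
    and "\<And>s t. distr M borel (Z s) = distr M borel (Z t)"
    and "\<And>t. (\<integral>\<omega>. Z t \<omega> \<partial>M) = 0"
    and "\<And>t. (\<integral>\<omega>. (Z t \<omega>)\<^sup>2 \<partial>M) = 1"
    and "\<And>j u. u \<in> {0..1} \<Longrightarrow> 0 \<le> a j u"
    and "0 < \<rho>" and "0 < Q" and "0 < B" and "0 < \<nu>" and "\<nu> < 1"
    and "\<And>j. 0 < l j"
    and "(\<lambda>j. real j / l j) summable_on {1..}"
    and "(INF u\<in>{0..1}. a 0 u) > \<rho>"
    and "\<And>j u. u \<in> {0..1} \<Longrightarrow> a j u \<le> Q / l j"
    and "\<And>j u v. u \<in> {0..1} \<Longrightarrow> v \<in> {0..1} \<Longrightarrow> \<bar>a j u - a j v\<bar> \<le> B * \<bar>u - v\<bar> / l j"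
    and "Q * (\<Sum>\<^sub>\<infinity>j\<in>{1..}. 1 / l j) \<le> 1 - \<nu>"
    and "\<And>j. da 0 j = a j"
    and "\<And>i j u. i < 3 \<Longrightarrow> u \<in> {0..1} \<Longrightarrow>
           (da i j has_real_derivative da (Suc i) j u) (at u within {0..1})"
    and "\<And>i j u. i \<in> {1, 2, 3} \<Longrightarrow> u \<in> {0..1} \<Longrightarrow> \<bar>da i j u\<bar> \<le> C / l j"
    and "stationary_arch M Z a X"
  shows "(AE \<omega> in M. \<forall>t. \<forall>u\<in>{0<..<1}. \<forall>i<3.
            (deriv ^^ i) (\<lambda>v. (X v t \<omega>)\<^sup>2) field_differentiable at u) \<and>
         (\<forall>u\<in>{0<..<1}. \<exists>D :: nat \<Rightarrow> int \<Rightarrow> 'w \<Rightarrow> real.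
            (\<forall>i\<in>{1, 2, 3}.
               stationary_process M (D i) \<and> sq_deriv_process M X i u (D i) \<and>
               (\<forall>X' D'. stationary_arch M Z a X' \<longrightarrow> sq_deriv_process M X' i u D' \<longrightarrow>
                  (AE \<omega> in M. \<forall>t. D' t \<omega> = D i t \<omega>))) \<and>
            (\<forall>t. integrable M (D 1 t)) \<and>
            derivative_equation M Z a (da 1) X u (D 1) \<and>
            (\<forall>Y. stationary_process M Y \<longrightarrow> (\<forall>t. integrable M (Y t)) \<longrightarrow>
               derivative_equation M Z a (da 1) X u Y \<longrightarrow>
               (AE \<omega> in M. \<forall>t. Y t \<omega> = D 1 t \<omega>)))"
proof -
  note indep = assms(2) and ident = assms(3) and unit = assms(5) and a_nonneg = assms(6)
    and Q = \<open>0 < Q\<close> and \<nu> = \<open>0 < \<nu>\<close> and l = assms(12) and moment = assms(13)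
    and a_le = assms(15) and contraction = assms(17) and da_0 = assms(18)
    and da_deriv = assms(19) and da_le = assms(20) and X = assms(21)
  have a_eq: "a = da 0" using da_0 by auto
  define q where "q j = Q / l j" for j
  define K where "K = max 1 (C / Q)"
  define m where "m = (\<Sum>\<^sub>\<infinity>j. real (Suc j) / l (Suc j))"
  \<comment> \<open>The choice of \<open>\<epsilon>\<close> lets the tilt use up at most half of the gap \<open>\<nu>\<close> to criticality.\<close>
  define \<epsilon> where "\<epsilon> = min 1 (\<nu> / (2 * (1 + Q * m)))"
  have m0: "0 \<le> m" unfolding m_def using l by (intro infsum_nonneg) (simp add: less_imp_le)
  have \<epsilon>: "0 < \<epsilon>" "\<epsilon> \<le> 1" using \<nu> Q m0 by (auto simp: \<epsilon>_def add_pos_nonneg)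
  have moment': "(\<lambda>j. real (Suc j) / l (Suc j)) summable_on UNIV"
    using moment by (subst (asm) summable_on_from_1[symmetric])
  have recip: "(\<lambda>j. 1 / l (Suc j)) summable_on UNIV"
    by (rule summable_on_dominated[OF moment'])
      (use l in \<open>auto simp: less_imp_le abs_of_pos intro!: divide_right_mono\<close>)
  have tilted: "(1 + \<epsilon> * real (Suc j)) * q (Suc j) = Q * (1 / l (Suc j)) + \<epsilon> * Q * (real (Suc j) / l (Suc j))" for j
    using l[of "Suc j"] by (simp add: q_def field_simps)
  have tilted_sum: "(\<Sum>\<^sub>\<infinity>j. (1 + \<epsilon> * real (Suc j)) * q (Suc j)) = Q * (\<Sum>\<^sub>\<infinity>j\<in>{1..}. 1 / l j) + \<epsilon> * Q * m"
    unfolding tilted m_def infsum_from_1[of "\<lambda>j. 1 / l j", symmetric]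
    by (subst infsum_add[OF summable_on_cmult_right[OF recip] summable_on_cmult_right[OF moment']])
      (simp only: infsum_cmult_right')
  have "\<epsilon> * (Q * m) \<le> \<nu> / (2 * (1 + Q * m)) * (1 + Q * m)"
    using \<epsilon> Q m0 by (intro mult_mono) (auto simp: \<epsilon>_def)
  also have "\<dots> = \<nu> / 2"
    using add_pos_nonneg[of 1 "Q * m"] Q m0 by (simp add: field_simps)
  finally have tilt_small: "\<epsilon> * Q * m \<le> \<nu> / 2" by (simp add: mult.assoc)
  interpret prob_space M by fact
  interpret arch_innovations M da q K \<epsilon> Z
  proof
    show "\<bar>da i j u\<bar> \<le> K ^ i * q j" if "i \<le> 3" and u: "u \<in> {0..1}" for i j u
    proof (cases "i = 0")
      case True
      then show ?thesis using a_nonneg[OF u, of j] a_le[OF u, of j] da_0[of j] by (simp add: q_def)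
    next
      case False
      then have "i \<in> {1, 2, 3}" using \<open>i \<le> 3\<close> by auto
      then have "\<bar>da i j u\<bar> \<le> C / Q * q j" using da_le[OF _ u, of i j] Q by (simp add: q_def)
      also have "\<dots> \<le> K ^ i * q j"
      proof (rule mult_right_mono)
        have "C / Q \<le> K ^ 1" by (simp add: K_def)
        also have "\<dots> \<le> K ^ i" using False by (intro power_increasing) (auto simp: K_def)
        finally show "C / Q \<le> K ^ i" .
        show "0 \<le> q j" using Q l[of j] by (simp add: q_def)
      qed
      finally show ?thesis .
    qed
    show "(\<lambda>j. (1 + \<epsilon> * real (Suc j)) * q (Suc j)) summable_on UNIV"
      unfolding tilted by (intro summable_on_add summable_on_cmult_right recip moment')
    show "(\<Sum>\<^sub>\<infinity>j. (1 + \<epsilon> * real (Suc j)) * q (Suc j)) < 1"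
      unfolding tilted_sum using contraction tilt_small \<nu> by linarith
  qed (use da_deriv \<epsilon> Q l indep ident unit in \<open>auto simp: K_def q_def\<close>)
  show ?thesis
    unfolding a_eq
  proof (intro conjI ballI)
    note X = X[unfolded a_eq]
    show "AE \<omega> in M. \<forall>t. \<forall>u\<in>{0<..<1}. \<forall>i<3. (deriv ^^ i) (\<lambda>v. (X v t \<omega>)\<^sup>2) field_differentiable at u"
      by (rule AE_square_differentiable[OF X])
    fix u :: real assume u: "u \<in> {0<..<1}"
    then have u': "u \<in> {0..1}" by auto
    define D where "D i t \<omega> = kernel_functional i u (\<lambda>s. Z s \<omega>) t" for i t \<omega>
    have D_stat: "stationary_process M (D i)" for i
      unfolding D_def by (rule kernel_functional_stationary)
    have D_deriv: "sq_deriv_process M X' i u (D i)" if "stationary_arch M Z (da 0) X'" "i \<in> {1, 2, 3}" for X' i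
      unfolding D_def using that by (intro sq_deriv_process_kernel_functional u) auto
    have D_int: "integrable M (D 1 t)" for t
      unfolding D_def by (rule kernel_functional_integrable[OF u']) simp
    have D_eq: "derivative_equation M Z (da 0) (da 1) X u (D 1)"
      unfolding D_def by (rule derivative_equation_kernel_functional[OF X u'])
    have D_unique: "AE \<omega> in M. \<forall>t. D' t \<omega> = D i t \<omega>"
      if "stationary_arch M Z (da 0) X'" "sq_deriv_process M X' i u D'" "i \<in> {1, 2, 3}" for X' D' i
      using D_deriv[OF that(1,3)] that(2) unfolding sq_deriv_process_def
      by eventually_elim simp
    show "\<exists>D :: nat \<Rightarrow> int \<Rightarrow> 'w \<Rightarrow> real.
            (\<forall>i\<in>{1, 2, 3}.
               stationary_process M (D i) \<and> sq_deriv_process M X i u (D i) \<and>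
               (\<forall>X' D'. stationary_arch M Z (da 0) X' \<longrightarrow> sq_deriv_process M X' i u D' \<longrightarrow>
                  (AE \<omega> in M. \<forall>t. D' t \<omega> = D i t \<omega>))) \<and>
            (\<forall>t. integrable M (D 1 t)) \<and>
            derivative_equation M Z (da 0) (da 1) X u (D 1) \<and>
            (\<forall>Y. stationary_process M Y \<longrightarrow> (\<forall>t. integrable M (Y t)) \<longrightarrow>
               derivative_equation M Z (da 0) (da 1) X u Y \<longrightarrow>
               (AE \<omega> in M. \<forall>t. Y t \<omega> = D 1 t \<omega>))"
      by (intro exI[of _ D] conjI ballI allI impI D_stat D_deriv[OF X] D_int D_eq D_unique
            derivative_equation_unique[OF u' _ _ _ D_eq D_stat D_int]) auto
  qed
qed

end
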